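(* Fix $\alpha\ge0$, two positive integers $k_1\le k_2$ and an interval $(a,b)\subset\mathbb{R}$. For $i\in\{1,2\}$ let $\vec x^{(i)},\vec y^{(i)}\in[0,\infty)^{k_2-k_1+1}$ be vectors satisfying $x^{(1)}_j\ge x^{(2)}_j$ and $y^{(1)}_j\ge y^{(2)}_j$ for all $j\in\{k_1,\dots,k_2\}$. For $i\in\{1,2\}$ let $(f^{(i)},g^{(i)})$ be pairs of functions on $[a,b]$ satisfying the continuity assumption, with $f^{(1)}(t)\ge f^{(2)}(t)$ and $g^{(1)}(t)\ge g^{(2)}(t)$ for all $t\in[a,b]$. Further assume that for $i\in\{1,2\}$ $$Z^{k_1,k_2,(a,b),\vec x^{(i)},\vec y^{(i)},f^{(i)},g^{(i)}}>0.$$ Let $\mathcal{Q}^{(i)}=\{\mathcal{Q}^{(i)}_j\}_{j=k_1}^{k_2}$ be a $\{k_1,\dots,k_2\}\times[a,b]$-indexed line ensemble whose law $\mathbb{P}^{(i)}$ is the non-intersecting squared $\alpha$-Bessel bridge ensemble $\mathbb{P}^{k_1,k_2,(a,b),\vec x^{(i)},\vec y^{(i)},f^{(i)},g^{(i)}}$. Then there exists a coupling of the probability measures $\mathbb{P}^{(1)}$ and $\mathbb{P}^{(2)}$ such that almost surely $\mathcal{Q}^{(1)}_j(t)\ge\mathcal{Q}^{(2)}_j(t)$ for all $j\in\{k_1,\dots,k_2\}$ and $t\in[a,b]$.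
   Context: **Continuity assumption.** A pair $(f,g)$ of functions on $[a,b]$ satisfies the continuity assumption if: $f:[a,b]\to[0,\infty)$ is upper semi-continuous and $g:[a,b]\to(0,\infty]$ is lower semi-continuous; $f$ and $g$ are continuous at $a$ and $b$; and for all $t\in(a,b)$, $f$ and $g$ are one-sided continuous at $t$. **Squared Bessel bridges.** Let $h_\alpha(z)=2^{-\alpha}\sum_{n\ge0}\frac{(z/2)^{2n}}{n!\,\Gamma(n+\alpha+1)}$ and $p_t(x,y)=t^{-\alpha-1}y^{2\alpha+1}e^{-(x^2+y^2)/(2t)}h_\alpha(xy/t)$, $x,y\ge0$ (transition density of the $\alpha$-Bessel process). For $x,y\ge 0$ and $T>0$, an $\alpha$-Bessel bridge on $[0,T]$ with entrance and exit data $(x,y)$ is a continuous process $\mathcal{S}$ with $\mathcal{S}(0)=x$, $\mathcal{S}(T)=y$ such that for all $0<t_1<\dots<t_m<T$ the joint density of $(\mathcal{S}(t_1),\dots,\mathcal{S}(t_m))$ at $(z_1,\dots,z_m)$ is $p_{t_1}(x,z_1)p_{t_2-t_1}(z_1,z_2)\cdots p_{T-t_m}(z_m,y)/p_T(x,y)$ (for $y=0$, the limit as $y\downarrow0$). A squared $\alpha$-Bessel bridge with data $(x,y)$ is the square of an $\alpha$-Bessel bridge with data $(\sqrt{x},\sqrt{y})$. Bridges on $[a,b]$ are obtained by time translation. **Bridge ensembles.** $\mathbb{P}_{\mathrm{free}}^{k_1,k_2,(a,b),\vec x,\vec y}$ is the law on $C(\{k_1,\dots,k_2\}\times[a,b],\mathbb{R})$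 of independent squared $\alpha$-Bessel bridges $\mathcal{J}_{k_1},\dots,\mathcal{J}_{k_2}$ on $[a,b]$ with entrance and exit data $(\vec x,\vec y)$ (coordinates indexed by $k_1,\dots,k_2$). The normalizing constant $Z^{k_1,k_2,(a,b),\vec x,\vec y,f,g}$ is the $\mathbb{P}_{\mathrm{free}}^{k_1,k_2,(a,b),\vec x,\vec y}$-probability of $\{f<\mathcal{J}_{k_1}<\dots<\mathcal{J}_{k_2}<g\text{ on }[a,b]\}$, and when it is positive $\mathbb{P}^{k_1,k_2,(a,b),\vec x,\vec y,f,g}$ is $\mathbb{P}_{\mathrm{free}}^{k_1,k_2,(a,b),\vec x,\vec y}$ conditioned on this event. *)

theory Defs
  imports "HOL-Probability.Probability"
begin

section \<open>Boundary data\<close>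

definition usc_on :: "real set \<Rightarrow> (real \<Rightarrow> 'b::linorder_topology) \<Rightarrow> bool" where
  "usc_on S f \<longleftrightarrow> (\<forall>t\<in>S. \<forall>c>f t. \<forall>\<^sub>F s in at t within S. f s < c)"

definition lsc_on :: "real set \<Rightarrow> (real \<Rightarrow> 'b::linorder_topology) \<Rightarrow> bool" where
  "lsc_on S f \<longleftrightarrow> (\<forall>t\<in>S. \<forall>c<f t. \<forall>\<^sub>F s in at t within S. c < f s)"

definition one_sided_continuous_at :: "(real \<Rightarrow> 'b::t2_space) \<Rightarrow> real \<Rightarrow> bool" where
  "one_sided_continuous_at f t \<longleftrightarrow> continuous (at_left t) f \<or> continuous (at_right t) f"

text \<open>
  The upper boundary \<open>g\<close> may take the value \<open>\<infinity>\<close>; its continuity refers to the topology of the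
  extended real line. At an interior point, \<open>f\<close> and \<open>g\<close> need not be continuous from the same side.
\<close>

definition continuity_assumption ::
  "real \<Rightarrow> real \<Rightarrow> (real \<Rightarrow> real) \<Rightarrow> (real \<Rightarrow> ereal) \<Rightarrow> bool" where
  "continuity_assumption a b f g \<longleftrightarrow>
     (\<forall>t\<in>{a..b}. 0 \<le> f t) \<and> usc_on {a..b} f \<and>
     (\<forall>t\<in>{a..b}. 0 < g t) \<and> lsc_on {a..b} g \<and>
     (\<forall>t\<in>{a, b}. continuous (at t within {a..b}) f \<and> continuous (at t within {a..b}) g) \<and>
     (\<forall>t\<in>{a<..<b}. one_sided_continuous_at f t \<and> one_sided_continuous_at g t)"


section \<open>Squared Bessel bridges\<close>

definition bessel_h :: "real \<Rightarrow> real \<Rightarrow> real" where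
  "bessel_h \<alpha> z =
     2 powr (- \<alpha>) * (\<Sum>n. (z / 2) ^ (2 * n) / (fact n * Gamma (real n + \<alpha> + 1)))"

definition bessel_p :: "real \<Rightarrow> real \<Rightarrow> real \<Rightarrow> real \<Rightarrow> real" where
  "bessel_p \<alpha> t x y =
     t powr (- \<alpha> - 1) * y powr (2 * \<alpha> + 1) * exp (- (x\<^sup>2 + y\<^sup>2) / (2 * t)) * bessel_h \<alpha> (x * y / t)"

text \<open>
  Times \<open>t 1 < \<dots> < t m\<close> and positions \<open>z 1, \<dots>, z m\<close> are given as functions on the naturals,
  of which only the values at the indices \<open>1, \<dots>, m\<close> matter.
\<close>

definition bridge_ratio ::
  "real \<Rightarrow> real \<Rightarrow> real \<Rightarrow> real \<Rightarrow> nat \<Rightarrow> (nat \<Rightarrow> real) \<Rightarrow> (nat \<Rightarrow> real) \<Rightarrow> real" where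
  "bridge_ratio \<alpha> T x y m t z =
     bessel_p \<alpha> (t 1) x (z 1)
     * (\<Prod>i\<in>{1..<m}. bessel_p \<alpha> (t (Suc i) - t i) (z i) (z (Suc i)))
     * bessel_p \<alpha> (T - t m) (z m) y / bessel_p \<alpha> T x y"

text \<open>
  For \<open>y = 0\<close> the ratio is of the form \<open>0 / 0\<close> and is replaced by its limit. The Bessel process lives
  on \<open>[0, \<infinity>)\<close>, so the density with respect to Lebesgue measure vanishes off the positive orthant.
\<close>

definition bridge_density ::
  "real \<Rightarrow> real \<Rightarrow> real \<Rightarrow> real \<Rightarrow> nat \<Rightarrow> (nat \<Rightarrow> real) \<Rightarrow> (nat \<Rightarrow> real) \<Rightarrow> real" where
  "bridge_density \<alpha> T x y m t z =
     (if \<forall>i\<in>{1..m}. 0 \<le> z i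
      then if y = 0 then Lim (at_right 0) (\<lambda>y'. bridge_ratio \<alpha> T x y' m t z)
           else bridge_ratio \<alpha> T x y m t z
      else 0)"

definition bessel_bridge ::
  "real \<Rightarrow> real \<Rightarrow> real \<Rightarrow> real \<Rightarrow> 'w measure \<Rightarrow> (real \<Rightarrow> 'w \<Rightarrow> real) \<Rightarrow> bool" where
  "bessel_bridge \<alpha> T x y M S \<longleftrightarrow>
     prob_space M \<and>
     (\<forall>t\<in>{0..T}. S t \<in> borel_measurable M) \<and>
     (\<forall>\<omega>\<in>space M. continuous_on {0..T} (\<lambda>t. S t \<omega>)) \<and>
     (AE \<omega> in M. S 0 \<omega> = x \<and> S T \<omega> = y) \<and>
     (\<forall>m t. 1 \<le> m \<longrightarrow> 0 < t 1 \<longrightarrow> strict_mono_on {1..m} t \<longrightarrow> t m < T \<longrightarrow>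
        distributed M (\<Pi>\<^sub>M i\<in>{1..m}. lborel) (\<lambda>\<omega>. \<lambda>i\<in>{1..m}. S (t i) \<omega>)
          (\<lambda>z. ennreal (bridge_density \<alpha> T x y m t z)))"

text \<open>
  Being a squared bridge is a property of the law of \<open>J\<close>. Asking for \<open>S\<close> on the same probability
  space is no restriction, since one can take \<open>S = sqrt (max 0 J)\<close>; the squaring relation is
  almost sure because a path space also contains paths with negative values.
\<close>

definition squared_bessel_bridge ::
  "real \<Rightarrow> real \<Rightarrow> real \<Rightarrow> real \<Rightarrow> 'w measure \<Rightarrow> (real \<Rightarrow> 'w \<Rightarrow> real) \<Rightarrow> bool" where
  "squared_bessel_bridge \<alpha> T x y M J \<longleftrightarrow>
     (\<exists>S. bessel_bridge \<alpha> T (sqrt x) (sqrt y) M S \<and>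
          (AE \<omega> in M. \<forall>t\<in>{0..T}. J t \<omega> = (S t \<omega>)\<^sup>2))"

definition squared_bessel_bridge_on ::
  "real \<Rightarrow> real \<Rightarrow> real \<Rightarrow> real \<Rightarrow> real \<Rightarrow> 'w measure \<Rightarrow> (real \<Rightarrow> 'w \<Rightarrow> real) \<Rightarrow> bool" where
  "squared_bessel_bridge_on \<alpha> a b x y M J \<longleftrightarrow>
     squared_bessel_bridge \<alpha> (b - a) x y M (\<lambda>t. J (a + t))"


section \<open>Bridge ensembles\<close>

text \<open>
  \<open>C({k\<^sub>1, \<dots>, k\<^sub>2} \<times> [a, b], \<real>)\<close> with the \<open>\<sigma>\<close>-algebra generated by the evaluations, which is the
  Borel \<open>\<sigma>\<close>-algebra of uniform convergence.
\<close>

type_synonym ensemble = "nat \<times> real \<Rightarrow> real"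

definition ensemble_space :: "nat \<Rightarrow> nat \<Rightarrow> real \<Rightarrow> real \<Rightarrow> ensemble measure" where
  "ensemble_space k1 k2 a b =
     restrict_space (\<Pi>\<^sub>M p\<in>{k1..k2} \<times> {a..b}. borel) {\<omega>. continuous_on ({k1..k2} \<times> {a..b}) \<omega>}"

definition free_bridge_law ::
  "real \<Rightarrow> nat \<Rightarrow> nat \<Rightarrow> real \<Rightarrow> real \<Rightarrow> (nat \<Rightarrow> real) \<Rightarrow> (nat \<Rightarrow> real) \<Rightarrow> ensemble measure \<Rightarrow> bool" where
  "free_bridge_law \<alpha> k1 k2 a b x y P \<longleftrightarrow>
     prob_space P \<and>
     sets P = sets (ensemble_space k1 k2 a b) \<and>
     (\<forall>j\<in>{k1..k2}. squared_bessel_bridge_on \<alpha> a b (x j) (y j) P (\<lambda>t \<omega>. \<omega> (j, t))) \<and>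
     prob_space.indep_vars P (\<lambda>j. \<Pi>\<^sub>M t\<in>{a..b}. borel) (\<lambda>j \<omega>. \<lambda>t\<in>{a..b}. \<omega> (j, t)) {k1..k2}"

definition nonint_event ::
  "nat \<Rightarrow> nat \<Rightarrow> real \<Rightarrow> real \<Rightarrow> (real \<Rightarrow> real) \<Rightarrow> (real \<Rightarrow> ereal) \<Rightarrow> ensemble set" where
  "nonint_event k1 k2 a b f g =
     {\<omega> \<in> space (ensemble_space k1 k2 a b). \<forall>t\<in>{a..b}.
        f t < \<omega> (k1, t) \<and>
        (\<forall>j\<in>{k1..<k2}. \<omega> (j, t) < \<omega> (Suc j, t)) \<and>
        ereal (\<omega> (k2, t)) < g t}"

definition normalizing_constant ::
  "nat \<Rightarrow> nat \<Rightarrow> real \<Rightarrow> real \<Rightarrow> (real \<Rightarrow> real) \<Rightarrow> (real \<Rightarrow> ereal) \<Rightarrow> ensemble measure \<Rightarrow> real" where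
  "normalizing_constant k1 k2 a b f g P = measure P (nonint_event k1 k2 a b f g)"

text \<open>Here \<open>uniform_measure P A\<close> is \<open>P\<close> conditioned on the event \<open>A\<close>.\<close>

definition nonint_law ::
  "nat \<Rightarrow> nat \<Rightarrow> real \<Rightarrow> real \<Rightarrow> (real \<Rightarrow> real) \<Rightarrow> (real \<Rightarrow> ereal) \<Rightarrow> ensemble measure
     \<Rightarrow> ensemble measure" where
  "nonint_law k1 k2 a b f g P = uniform_measure P (nonint_event k1 k2 a b f g)"

definition coupling :: "('a \<times> 'b) measure \<Rightarrow> 'a measure \<Rightarrow> 'b measure \<Rightarrow> bool" where
  "coupling \<mu> M N \<longleftrightarrow>
     prob_space \<mu> \<and> sets \<mu> = sets (M \<Otimes>\<^sub>M N) \<and> distr \<mu> M fst = M \<and> distr \<mu> N snd = N"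

end

theory Submission
  imports Defs
begin

text \<open>
  The transition density of the Bessel process is totally positive of order two, because the
  coefficients of the power series \<open>h\<close> are nonnegative. Hence the finite-dimensional laws of the two
  free ensembles satisfy the hypothesis of the four functions theorem, and so do their restrictions to
  the events that the curves keep a distance \<open>e\<close> from each other and from the boundaries at finitely
  many times. Both laws therefore satisfy Holley's lattice condition for the bits ``curve \<open>j\<close> is at
  least \<open>q\<close> at time \<open>s\<close>'' (\<open>s\<close>, \<open>q\<close> rational), first for finitely many times and \<open>e > 0\<close>, and by monotone
  limits for the non-intersecting ensembles.

  Reveal the bits one after the other. By the lattice condition the conditional probability of the next
  bit is larger for the first ensemble whenever the earlier bits are ordered; sampling it with a common
  uniform variable preserves the order. The bits determine the continuous curves, so this is the coupling,
  and neither Strassen's theorem nor a compactness argument is needed.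
\<close>

section \<open>The four functions theorem\<close>

text \<open>Non-intersection is a strict condition at uncountably many times, and only weak
  inequalities pass to limits: strict ones at all rational times could become equalities elsewhere.
  This is the reason for the gap \<open>e\<close>. With \<open>e\<close> fixed, finitely many times
  grow to all rational times, and continuity carries the gap to the whole interval; only then does
  \<open>e\<close> tend to 0, semicontinuity and compactness giving every non-intersecting family
  some gap.

  The lattice argument is run on square roots, where the bridge density is explicit. Exit value 0
  would turn it into a limit of ratios; this cannot occur, because a positive normalizing constant
  forces positive exit data.

  Thresholds are used for two reasons. Conditional probabilities given finitely many bits are plain
  ratios, so no conditional distributions of paths are required. And a threshold bit of a maximum or
  minimum is the disjunction or conjunction of the two bits, so lattice operations on curves become
  lattice operations on bits.\<close>

definition four_functions :: "'a::lattice measure \<Rightarrow> 'a measure \<Rightarrow> bool" where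
  "four_functions M N \<longleftrightarrow>
     sets M = sets N \<and>
     (\<forall>u\<in>space M. \<forall>v\<in>space M. sup u v \<in> space M \<and> inf u v \<in> space M) \<and>
     (\<forall>f1 f2 f3 f4 :: 'a \<Rightarrow> ennreal.
        f1 \<in> borel_measurable M \<longrightarrow> f2 \<in> borel_measurable N \<longrightarrow>
        f3 \<in> borel_measurable M \<longrightarrow> f4 \<in> borel_measurable N \<longrightarrow>
        (\<forall>u\<in>space M. \<forall>v\<in>space M. f1 u * f2 v \<le> f3 (sup u v) * f4 (inf u v)) \<longrightarrow>
        (\<integral>\<^sup>+x. f1 x \<partial>M) * (\<integral>\<^sup>+x. f2 x \<partial>N) \<le> (\<integral>\<^sup>+x. f3 x \<partial>M) * (\<integral>\<^sup>+x. f4 x \<partial>N))"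

lemma four_functionsD:
  assumes "four_functions M N"
    and "f1 \<in> borel_measurable M" "f2 \<in> borel_measurable N"
    and "f3 \<in> borel_measurable M" "f4 \<in> borel_measurable N"
    and "\<And>u v. u \<in> space M \<Longrightarrow> v \<in> space M \<Longrightarrow> f1 u * f2 v \<le> f3 (sup u v) * f4 (inf u v)"
  shows "(\<integral>\<^sup>+x. f1 x \<partial>M) * (\<integral>\<^sup>+x. f2 x \<partial>N) \<le> (\<integral>\<^sup>+x. f3 x \<partial>M) * (\<integral>\<^sup>+x. f4 x \<partial>N :: ennreal)"
  using assms unfolding four_functions_def by blast

lemma four_functions_sets: "four_functions M N \<Longrightarrow> sets M = sets N"
  by (simp add: four_functions_def)

lemma four_functions_space:
  assumes "four_functions M N" "u \<in> space M" "v \<in> space M"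
  shows "sup u v \<in> space M" "inf u v \<in> space M"
  using assms unfolding four_functions_def by blast+

text \<open>Expanding (c - a)(c - b) \<ge> 0 gives c(a + b) \<le> c^2 + ab \<le> c(c + d), and c
  cancels. What remains are infinite values and c = 0, which forces a = b = 0.\<close>

lemma ennreal_sum_le_of_prod_le:
  fixes a b c d :: ennreal
  assumes "a \<le> c" "b \<le> c" "a * b \<le> c * d"
  shows "a + b \<le> c + d"
proof -
  consider "c = \<top>" | "d = \<top>" | "c = 0" | "c \<noteq> \<top>" "d \<noteq> \<top>" "c \<noteq> 0" by auto
  then show ?thesis
  proof cases
    case 4
    then have "a \<noteq> \<top>" "b \<noteq> \<top>" using assms top_unique by auto
    with 4 obtain a' b' c' d' where r: "a = ennreal a'" "b = ennreal b'" "c = ennreal c'" "d = ennreal d'"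
      "0 \<le> a'" "0 \<le> b'" "0 \<le> c'" "0 \<le> d'"
      by (metis ennreal_cases)
    have "c' \<noteq> 0" using 4 r by auto
    have le: "a' \<le> c'" "b' \<le> c'" "a' * b' \<le> c' * d'"
      using assms r by (auto simp: ennreal_mult[symmetric])
    have "0 \<le> (c' - a') * (c' - b')" using le by simp
    then have "c' * (a' + b') \<le> c' * (c' + d')"
      using le by (simp add: algebra_simps)
    then have "a' + b' \<le> c' + d'"
      using \<open>c' \<noteq> 0\<close> r by simp
    then show ?thesis using r by (simp add: ennreal_plus[symmetric] del: ennreal_plus)
  qed (use assms in auto)
qed

text \<open>Symmetrising the double integral in \<open>x\<close> and \<open>y\<close> reduces the claim to a pointwise inequality.\<close>

lemma four_functions_lborel: "four_functions lborel (lborel :: real measure)"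
  unfolding four_functions_def
proof (intro conjI allI impI ballI)
  fix f1 f2 f3 f4 :: "real \<Rightarrow> ennreal"
  assume [measurable]: "f1 \<in> borel_measurable lborel" "f2 \<in> borel_measurable lborel"
    "f3 \<in> borel_measurable lborel" "f4 \<in> borel_measurable lborel"
  assume le: "\<forall>u\<in>space lborel. \<forall>v\<in>space lborel. f1 u * f2 v \<le> f3 (sup u v) * f4 (inf u v)"
  let ?I = "\<lambda>f. \<integral>\<^sup>+x. f x \<partial>lborel :: ennreal"
  have sym: "(\<integral>\<^sup>+x. \<integral>\<^sup>+y. f x * g y + f y * g x \<partial>lborel \<partial>lborel) = 2 * (?I f * ?I g)"
    if [measurable]: "f \<in> borel_measurable lborel" "g \<in> borel_measurable lborel" for f g :: "real \<Rightarrow> ennreal"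
    by (simp add: nn_integral_add nn_integral_cmult nn_integral_multc mult_2)
  have "2 * (?I f1 * ?I f2) \<le> 2 * (?I f3 * ?I f4)"
    unfolding sym[symmetric, OF \<open>f1 \<in> _\<close> \<open>f2 \<in> _\<close>] sym[symmetric, OF \<open>f3 \<in> _\<close> \<open>f4 \<in> _\<close>]
  proof (intro nn_integral_mono)
    \<comment> \<open>For \<open>y \<le> x\<close> both crossed pairs have join x and meet y, so
      \<open>f3 x * f4 y\<close> dominates each summand on the left. The diagonal cases
      \<open>u = v = x\<close> and \<open>u = v = y\<close> supply the bound on the product.\<close>
    have wlog: "f1 x * f2 y + f1 y * f2 x \<le> f3 x * f4 y + f3 y * f4 x" if "y \<le> x" for x y
    proof (rule ennreal_sum_le_of_prod_le)
      show "f1 x * f2 y \<le> f3 x * f4 y"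
        using le[rule_format, of x y] that by (simp add: sup_max inf_min)
      show "f1 y * f2 x \<le> f3 x * f4 y"
        using le[rule_format, of y x] that by (simp add: sup_max inf_min)
      have "(f1 x * f2 x) * (f1 y * f2 y) \<le> (f3 x * f4 x) * (f3 y * f4 y)"
        using mult_mono[OF le[rule_format, of x x] le[rule_format, of y y]] by simp
      then show "(f1 x * f2 y) * (f1 y * f2 x) \<le> (f3 x * f4 y) * (f3 y * f4 x)"
        by (simp add: ac_simps)
    qed
    show "f1 x * f2 y + f1 y * f2 x \<le> f3 x * f4 y + f3 y * f4 x" for x y
      using wlog[of x y] wlog[of y x] by (cases "y \<le> x") (auto simp: ac_simps)
  qed
  then show "?I f1 * ?I f2 \<le> ?I f3 * ?I f4"
    by (simp add: ennreal_mult_le_mult_iff)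
qed auto

text \<open>The densities are absorbed into the test functions: multiplying their cross inequality
  with that of the test functions gives the hypothesis for the products.\<close>

lemma four_functions_density:
  assumes "four_functions M N"
    and [measurable]: "p \<in> borel_measurable M" "q \<in> borel_measurable N"
    and le: "\<And>u v. u \<in> space M \<Longrightarrow> v \<in> space M \<Longrightarrow> p u * q v \<le> p (sup u v) * q (inf u v)"
  shows "four_functions (density M p) (density N q)"
  unfolding four_functions_def
proof (intro conjI allI impI ballI)
  fix f1 f2 f3 f4 :: "'a \<Rightarrow> ennreal"
  assume meas: "f1 \<in> borel_measurable (density M p)" "f2 \<in> borel_measurable (density N q)"
    "f3 \<in> borel_measurable (density M p)" "f4 \<in> borel_measurable (density N q)"
  then have [measurable]: "f1 \<in> borel_measurable M" "f2 \<in> borel_measurable N"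
    "f3 \<in> borel_measurable M" "f4 \<in> borel_measurable N" by simp_all
  assume f: "\<forall>u\<in>space (density M p). \<forall>v\<in>space (density M p). f1 u * f2 v \<le> f3 (sup u v) * f4 (inf u v)"
  have "(p u * f1 u) * (q v * f2 v) \<le> (p (sup u v) * f3 (sup u v)) * (q (inf u v) * f4 (inf u v))"
    if "u \<in> space M" "v \<in> space M" for u v
  proof -
    have "(p u * q v) * (f1 u * f2 v) \<le> (p (sup u v) * q (inf u v)) * (f3 (sup u v) * f4 (inf u v))"
      by (rule mult_mono[OF le f[rule_format]]) (use that in simp_all)
    then show ?thesis by (simp add: ac_simps)
  qed
  then have "(\<integral>\<^sup>+x. p x * f1 x \<partial>M) * (\<integral>\<^sup>+x. q x * f2 x \<partial>N)
      \<le> (\<integral>\<^sup>+x. p x * f3 x \<partial>M) * (\<integral>\<^sup>+x. q x * f4 x \<partial>N)"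
    by (intro four_functionsD[OF assms(1)]) auto
  then show "(\<integral>\<^sup>+x. f1 x \<partial>density M p) * (\<integral>\<^sup>+x. f2 x \<partial>density N q)
      \<le> (\<integral>\<^sup>+x. f3 x \<partial>density M p) * (\<integral>\<^sup>+x. f4 x \<partial>density N q)"
    by (simp add: nn_integral_density)
qed (use assms(1) in \<open>auto simp: four_functions_def\<close>)

text \<open>Fubini and induction: for fixed remaining coordinates u and v, the statement for the new
  coordinate, applied to the slices, is exactly the hypothesis for the partially integrated
  functions. The empty product is a single point, where hypothesis and claim coincide.\<close>

lemma four_functions_PiM:
  fixes M N :: "'i \<Rightarrow> 'a::lattice measure"
  assumes "finite I"
    and ff: "\<And>i. i \<in> I \<Longrightarrow> four_functions (M i) (N i)"
    and sf: "\<And>i. i \<in> I \<Longrightarrow> sigma_finite_measure (M i)" "\<And>i. i \<in> I \<Longrightarrow> sigma_finite_measure (N i)"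
  shows "four_functions (PiM I M) (PiM I N)"
  using assms
proof (induction I rule: finite_induct)
  case empty
  have eq: "PiM {} M = PiM {} N" by (intro PiM_cong) auto
  have "sup u v = (\<lambda>_. undefined)" "inf u v = (\<lambda>_. undefined)"
    if "u = (\<lambda>_. undefined)" "v = (\<lambda>_. undefined)" for u v :: "'i \<Rightarrow> 'a"
    using that by (auto simp: fun_eq_iff)
  then show ?case
    unfolding four_functions_def eq by (auto simp: PiM_empty nn_integral_count_space_finite)
next
  case (insert i I)
  \<comment> \<open>The product locale asks for sigma-finiteness at every index, also outside the
    finite set; null measures fill these places and leave the products unchanged.\<close>
  define M' where "M' j = (if j \<in> insert i I then M j else null_measure (M j))" for j
  define N' where "N' j = (if j \<in> insert i I then N j else null_measure (N j))" for j
  have null: "sigma_finite_measure (null_measure K)" for K :: "'a measure"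
    by (intro finite_measure.axioms(1) finite_measureI) simp
  interpret M: product_sigma_finite M'
    using insert.prems(2) null by (intro product_sigma_finite.intro) (simp add: M'_def)
  interpret N: product_sigma_finite N'
    using insert.prems(3) null by (intro product_sigma_finite.intro) (simp add: N'_def)
  have eqs: "PiM (insert i I) M = PiM (insert i I) M'" "PiM (insert i I) N = PiM (insert i I) N'"
    "PiM I M = PiM I M'" "PiM I N = PiM I N'" "M i = M' i" "N i = N' i"
    by (auto simp: M'_def N'_def intro!: PiM_cong)
  have IH: "four_functions (PiM I M') (PiM I N')"
    using insert.IH insert.prems unfolding eqs by auto
  have ffi: "four_functions (M' j) (N' j)" if "j \<in> insert i I" for j
    using insert.prems(1)[OF that] that by (simp add: M'_def N'_def)
  note sets_eq = four_functions_sets[OF ffi]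
  have space_eq: "space (M' j) = space (N' j)" if "j \<in> insert i I" for j
    using sets_eq[OF that] by (rule sets_eq_imp_space_eq)
  show ?case
    unfolding four_functions_def eqs
  proof (intro conjI allI impI ballI)
    show "sets (PiM (insert i I) M') = sets (PiM (insert i I) N')"
      by (intro sets_PiM_cong refl sets_eq)
    fix u v assume uv: "u \<in> space (PiM (insert i I) M')" "v \<in> space (PiM (insert i I) M')"
    show "sup u v \<in> space (PiM (insert i I) M')" "inf u v \<in> space (PiM (insert i I) M')"
      using uv four_functions_space[OF ffi]
      by (auto simp: space_PiM PiE_iff extensional_def)
  next
    fix f1 f2 f3 f4 :: "('i \<Rightarrow> 'a) \<Rightarrow> ennreal"
    assume [measurable]: "f1 \<in> borel_measurable (PiM (insert i I) M')" "f2 \<in> borel_measurable (PiM (insert i I) N')"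
      "f3 \<in> borel_measurable (PiM (insert i I) M')" "f4 \<in> borel_measurable (PiM (insert i I) N')"
    assume le: "\<forall>u\<in>space (PiM (insert i I) M'). \<forall>v\<in>space (PiM (insert i I) M').
      f1 u * f2 v \<le> f3 (sup u v) * f4 (inf u v)"
    let ?M = "\<lambda>f x. \<integral>\<^sup>+y. f (x(i := y)) \<partial>M' i :: ennreal"
    let ?N = "\<lambda>f x. \<integral>\<^sup>+y. f (x(i := y)) \<partial>N' i :: ennreal"
    have "(\<integral>\<^sup>+x. ?M f1 x \<partial>PiM I M') * (\<integral>\<^sup>+x. ?N f2 x \<partial>PiM I N')
      \<le> (\<integral>\<^sup>+x. ?M f3 x \<partial>PiM I M') * (\<integral>\<^sup>+x. ?N f4 x \<partial>PiM I N')"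
    proof (rule four_functionsD[OF IH])
      have mM: "?M f \<in> borel_measurable (PiM I M')" if [measurable]: "f \<in> borel_measurable (PiM (insert i I) M')" for f
        by (intro M.sigma_finite_measures sigma_finite_measure.borel_measurable_nn_integral) measurable
      have mN: "?N f \<in> borel_measurable (PiM I N')" if [measurable]: "f \<in> borel_measurable (PiM (insert i I) N')" for f
        by (intro N.sigma_finite_measures sigma_finite_measure.borel_measurable_nn_integral) measurable
      show "?M f1 \<in> borel_measurable (PiM I M')" "?M f3 \<in> borel_measurable (PiM I M')"
        "?N f2 \<in> borel_measurable (PiM I N')" "?N f4 \<in> borel_measurable (PiM I N')"
        by (auto intro!: mM mN)
      fix u v assume uv: "u \<in> space (PiM I M')" "v \<in> space (PiM I M')"
      have sIN: "space (PiM I M') = space (PiM I N')"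
        using four_functions_sets[OF IH] by (rule sets_eq_imp_space_eq)
      have supinf: "sup u v \<in> space (PiM I M')" "inf u v \<in> space (PiM I M')"
        using four_functions_space[OF IH uv] by auto
      have upd: "w(i := y) \<in> space (PiM (insert i I) M')" if "w \<in> space (PiM I M')" "y \<in> space (M' i)" for w y
        using that by (auto simp: space_PiM PiE_iff extensional_def)
      show "?M f1 u * ?N f2 v \<le> ?M f3 (sup u v) * ?N f4 (inf u v)"
      proof (rule four_functionsD[OF ffi])
        have m: "(\<lambda>y. f (w(i := y))) \<in> borel_measurable (K i)"
          if "w \<in> space (PiM I K)" and [measurable]: "f \<in> borel_measurable (PiM (insert i I) K)"
          for f :: "_ \<Rightarrow> ennreal" and w K
        proof -
          have "(\<lambda>y. w(i := y)) \<in> K i \<rightarrow>\<^sub>M PiM (insert i I) K"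
            by (rule measurable_compose[OF measurable_Pair1' measurable_add_dim, OF that(1), simplified])
          then show ?thesis by measurable
        qed
        show "(\<lambda>y. f1 (u(i := y))) \<in> borel_measurable (M' i)" "(\<lambda>y. f2 (v(i := y))) \<in> borel_measurable (N' i)"
          "(\<lambda>y. f3 ((sup u v)(i := y))) \<in> borel_measurable (M' i)"
          "(\<lambda>y. f4 ((inf u v)(i := y))) \<in> borel_measurable (N' i)"
          using uv supinf sIN by (auto intro!: m)
        fix y z assume yz: "y \<in> space (M' i)" "z \<in> space (M' i)"
        have "(sup u v)(i := sup y z) = sup (u(i := y)) (v(i := z))"
          "(inf u v)(i := inf y z) = inf (u(i := y)) (v(i := z))"
          by (auto simp: fun_eq_iff)
        then show "f1 (u(i := y)) * f2 (v(i := z)) \<le> f3 ((sup u v)(i := sup y z)) * f4 ((inf u v)(i := inf y z))"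
          using le upd uv yz by simp
      qed simp
    qed
    then show "(\<integral>\<^sup>+x. f1 x \<partial>PiM (insert i I) M') * (\<integral>\<^sup>+x. f2 x \<partial>PiM (insert i I) N')
      \<le> (\<integral>\<^sup>+x. f3 x \<partial>PiM (insert i I) M') * (\<integral>\<^sup>+x. f4 x \<partial>PiM (insert i I) N')"
      using insert.hyps by (simp add: M.product_nn_integral_insert N.product_nn_integral_insert)
  qed
qed

section \<open>Total positivity of the Bessel transition density\<close>

lemma power_mult_power_mono:
  fixes x y :: real
  assumes "0 \<le> y" "y \<le> x" "n \<le> m"
  shows "x ^ n * y ^ m \<le> x ^ m * y ^ n"
proof -
  obtain k where m: "m = n + k" using assms(3) le_Suc_ex by blast
  have "(x ^ n * y ^ n) * y ^ k \<le> (x ^ n * y ^ n) * x ^ k"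
    using assms by (intro mult_left_mono power_mono mult_nonneg_nonneg zero_le_power) auto
  then show ?thesis by (simp add: m power_add ac_simps)
qed

text \<open>Symmetrising in \<open>m\<close> and \<open>n\<close> turns the difference of the two sides into a sum of terms
  \<open>(x1^m x2^n - x1^n x2^m) (y1^m y2^n - y1^n y2^m)\<close>, whose factors have the same sign.\<close>

lemma polynomial_kernel_TP2:
  fixes a :: "nat \<Rightarrow> real" and N :: nat
  assumes a: "\<And>n. 0 \<le> a n" and x: "0 \<le> x2" "x2 \<le> x1" and y: "0 \<le> y2" "y2 \<le> y1"
  defines "S \<equiv> \<lambda>z. \<Sum>n<N. a n * z ^ n"
  shows "S (x1 * y2) * S (x2 * y1) \<le> S (x1 * y1) * S (x2 * y2)"
proof -
  let ?P = "\<lambda>m n. a m * a n * (x1 ^ m * x2 ^ n * (y1 ^ m * y2 ^ n - y2 ^ m * y1 ^ n))"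
  have "S (x1 * y1) * S (x2 * y2) - S (x1 * y2) * S (x2 * y1) = (\<Sum>m<N. \<Sum>n<N. ?P m n)"
    by (simp add: S_def sum_product sum_subtractf[symmetric] power_mult_distrib algebra_simps)
  moreover have "(\<Sum>m<N. \<Sum>n<N. ?P m n) = (\<Sum>m<N. \<Sum>n<N. ?P n m)"
    by (rule sum.swap)
  ultimately have "2 * (S (x1 * y1) * S (x2 * y2) - S (x1 * y2) * S (x2 * y1))
      = (\<Sum>m<N. \<Sum>n<N. ?P m n + ?P n m)"
    by (simp add: sum.distrib)
  also have "\<dots> = (\<Sum>m<N. \<Sum>n<N. a m * a n *
      ((x1 ^ m * x2 ^ n - x1 ^ n * x2 ^ m) * (y1 ^ m * y2 ^ n - y1 ^ n * y2 ^ m)))"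
    by (intro sum.cong) (simp_all add: algebra_simps)
  also have "\<dots> \<ge> 0"
  proof -
    have "0 \<le> (x1 ^ m * x2 ^ n - x1 ^ n * x2 ^ m) * (y1 ^ m * y2 ^ n - y1 ^ n * y2 ^ m)" for m n
      using power_mult_power_mono[OF x, of n m] power_mult_power_mono[OF y, of n m]
        power_mult_power_mono[OF x, of m n] power_mult_power_mono[OF y, of m n]
      by (cases "n \<le> m") (auto intro: mult_nonneg_nonneg mult_nonpos_nonpos)
    then show ?thesis by (intro sum_nonneg mult_nonneg_nonneg[OF mult_nonneg_nonneg[OF a a]])
  qed
  finally show ?thesis by simp
qed

lemma power_series_kernel_TP2:
  fixes a :: "nat \<Rightarrow> real"
  assumes a: "\<And>n. 0 \<le> a n" and sm: "\<And>z. summable (\<lambda>n. a n * z ^ n)"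
    and xy: "0 \<le> x2" "x2 \<le> x1" "0 \<le> y2" "y2 \<le> y1"
  defines "S \<equiv> \<lambda>z. \<Sum>n. a n * z ^ n"
  shows "S (x1 * y2) * S (x2 * y1) \<le> S (x1 * y1) * S (x2 * y2)"
proof (rule LIMSEQ_le)
  let ?S = "\<lambda>N z. \<Sum>n<N. a n * z ^ n"
  have "(\<lambda>N. ?S N z) \<longlonglongrightarrow> S z" for z
    unfolding S_def by (rule summable_LIMSEQ[OF sm])
  then show "(\<lambda>N. ?S N (x1 * y2) * ?S N (x2 * y1)) \<longlonglongrightarrow> S (x1 * y2) * S (x2 * y1)"
    "(\<lambda>N. ?S N (x1 * y1) * ?S N (x2 * y2)) \<longlonglongrightarrow> S (x1 * y1) * S (x2 * y2)"
    by (intro tendsto_mult; assumption)+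
  show "\<exists>N. \<forall>n\<ge>N. ?S n (x1 * y2) * ?S n (x2 * y1) \<le> ?S n (x1 * y1) * ?S n (x2 * y2)"
    using polynomial_kernel_TP2[of a, OF a xy] by blast
qed

section \<open>The Bessel kernel as a power series\<close>

definition bessel_coeff :: "real \<Rightarrow> nat \<Rightarrow> real" where
  "bessel_coeff \<alpha> n = 1 / (fact n * Gamma (real n + \<alpha> + 1))"

lemma bessel_coeff_nonneg: "0 \<le> \<alpha> \<Longrightarrow> 0 \<le> bessel_coeff \<alpha> n"
  unfolding bessel_coeff_def by (intro divide_nonneg_nonneg mult_nonneg_nonneg less_imp_le[OF Gamma_real_pos]) auto

text \<open>Each shift multiplies by a factor n + \<alpha> + 1 \<ge> 1. Hence the coefficients are
  at most 1 / (Gamma(\<alpha> + 1) n!) and the exponential series dominates.\<close>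

lemma Gamma_shift_ge:
  assumes "0 \<le> (\<alpha>::real)"
  shows "Gamma (\<alpha> + 1) \<le> Gamma (real n + \<alpha> + 1)"
proof (induction n)
  case (Suc n)
  have "Gamma (real (Suc n) + \<alpha> + 1) = (real n + \<alpha> + 1) * Gamma (real n + \<alpha> + 1)"
    using Gamma_plus1[of "real n + \<alpha> + 1"] assms by (auto simp: add_ac nonpos_Ints_def)
  also have "\<dots> \<ge> 1 * Gamma (real n + \<alpha> + 1)"
    using assms by (intro mult_right_mono less_imp_le[OF Gamma_real_pos]) auto
  finally show ?case using Suc by simp
qed simp

lemma summable_bessel_coeff:
  assumes "0 \<le> \<alpha>"
  shows "summable (\<lambda>n. bessel_coeff \<alpha> n * z ^ n)"
proof (rule summable_comparison_test)
  have G: "0 < Gamma (\<alpha> + 1)" using assms by (intro Gamma_real_pos) auto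
  have "norm (bessel_coeff \<alpha> n * z ^ n) \<le> (1 / Gamma (\<alpha> + 1)) * (inverse (fact n) * norm z ^ n)" for n
  proof -
    have "bessel_coeff \<alpha> n \<le> (1 / Gamma (\<alpha> + 1)) * inverse (fact n)"
      unfolding bessel_coeff_def using Gamma_shift_ge[OF assms, of n] G
      by (simp add: field_simps)
    then have "bessel_coeff \<alpha> n * norm z ^ n \<le> (1 / Gamma (\<alpha> + 1)) * inverse (fact n) * norm z ^ n"
      by (rule mult_right_mono) simp
    then show ?thesis
      using bessel_coeff_nonneg[OF assms, of n] by (simp add: abs_mult power_abs)
  qed
  then show "\<exists>N. \<forall>n\<ge>N. norm (bessel_coeff \<alpha> n * z ^ n)
      \<le> (1 / Gamma (\<alpha> + 1)) * (inverse (fact n) * norm z ^ n)" by blast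
  show "summable (\<lambda>n. (1 / Gamma (\<alpha> + 1)) * (inverse (fact n) * norm z ^ n))"
    by (intro summable_mult summable_exp)
qed

text \<open>In the variable z^2/4 the argument xy/t becomes the product of x^2 and y^2/(4t^2), which
  is the form of a power series kernel.\<close>

lemma bessel_h_eq:
  "bessel_h \<alpha> z = 2 powr (- \<alpha>) * (\<Sum>n. bessel_coeff \<alpha> n * (z\<^sup>2 / 4) ^ n)"
proof -
  have "(z / 2) ^ (2 * n) = (z\<^sup>2 / 4) ^ n" for n
    by (simp add: power_mult power_divide)
  then show ?thesis
    by (simp add: bessel_h_def bessel_coeff_def)
qed

lemma bessel_h_nonneg: "0 \<le> \<alpha> \<Longrightarrow> 0 \<le> bessel_h \<alpha> z"
  unfolding bessel_h_eq
  by (intro mult_nonneg_nonneg suminf_nonneg summable_bessel_coeff bessel_coeff_nonneg zero_le_power) auto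

lemma bessel_h_TP2:
  assumes "0 \<le> \<alpha>" "0 \<le> x2" "x2 \<le> x1" "0 \<le> y2" "y2 \<le> y1"
  shows "bessel_h \<alpha> (x1 * y2 / t) * bessel_h \<alpha> (x2 * y1 / t)
    \<le> bessel_h \<alpha> (x1 * y1 / t) * bessel_h \<alpha> (x2 * y2 / t)"
proof -
  define S where "S z = (\<Sum>n. bessel_coeff \<alpha> n * z ^ n)" for z
  have h: "bessel_h \<alpha> (x * y / t) = 2 powr (- \<alpha>) * S (x\<^sup>2 * (y\<^sup>2 / (4 * t\<^sup>2)))" for x y
    by (simp add: bessel_h_eq S_def power_mult_distrib power_divide mult.commute)
  have "S (x1\<^sup>2 * (y2\<^sup>2 / (4 * t\<^sup>2))) * S (x2\<^sup>2 * (y1\<^sup>2 / (4 * t\<^sup>2)))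
      \<le> S (x1\<^sup>2 * (y1\<^sup>2 / (4 * t\<^sup>2))) * S (x2\<^sup>2 * (y2\<^sup>2 / (4 * t\<^sup>2)))"
    unfolding S_def using assms
    by (intro power_series_kernel_TP2 bessel_coeff_nonneg summable_bessel_coeff)
       (auto intro!: divide_right_mono)
  then have "(2 powr (- \<alpha>) * 2 powr (- \<alpha>)) * (S (x1\<^sup>2 * (y2\<^sup>2 / (4 * t\<^sup>2))) * S (x2\<^sup>2 * (y1\<^sup>2 / (4 * t\<^sup>2))))
      \<le> (2 powr (- \<alpha>) * 2 powr (- \<alpha>)) * (S (x1\<^sup>2 * (y1\<^sup>2 / (4 * t\<^sup>2))) * S (x2\<^sup>2 * (y2\<^sup>2 / (4 * t\<^sup>2))))"
    by (intro mult_left_mono) auto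
  then show ?thesis by (simp only: h ac_simps)
qed

section \<open>Transition densities and bridge densities\<close>

lemma bessel_p_nonneg: "0 \<le> \<alpha> \<Longrightarrow> 0 \<le> bessel_p \<alpha> t x y"
  unfolding bessel_p_def by (intro mult_nonneg_nonneg bessel_h_nonneg) auto

text \<open>The Gaussian and power factors split into a function of the first and a function of the
  second argument, so they contribute the same product to both sides and only
  \<open>bessel_h\<close> has to be compared. If the two pairs are already ordered, the sides are
  equal; the content lies in the crossed cases.\<close>

lemma bessel_p_TP2:
  assumes \<alpha>: "0 \<le> \<alpha>" and nn: "0 \<le> x" "0 \<le> y" "0 \<le> x'" "0 \<le> y'"
  shows "bessel_p \<alpha> t x y * bessel_p \<alpha> t x' y'
    \<le> bessel_p \<alpha> t (max x x') (max y y') * bessel_p \<alpha> t (min x x') (min y y')"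
proof -
  define e where "e z = exp (- z\<^sup>2 / (2 * t))" for z
  define c where "c z = t powr (- \<alpha> - 1) * z powr (2 * \<alpha> + 1) * e z" for z
  have p: "bessel_p \<alpha> t z w = e z * c w * bessel_h \<alpha> (z * w / t)" for z w
    by (simp add: bessel_p_def c_def e_def exp_add[symmetric] diff_divide_distrib)
  have nonneg: "0 \<le> e z" "0 \<le> c z" for z by (simp_all add: e_def c_def)
  have cross: "bessel_p \<alpha> t z1 w2 * bessel_p \<alpha> t z2 w1 \<le> bessel_p \<alpha> t z1 w1 * bessel_p \<alpha> t z2 w2"
    if "0 \<le> z2" "z2 \<le> z1" "0 \<le> w2" "w2 \<le> w1" for z1 z2 w1 w2
  proof -
    have "(e z1 * e z2 * c w1 * c w2) * (bessel_h \<alpha> (z1 * w2 / t) * bessel_h \<alpha> (z2 * w1 / t))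
        \<le> (e z1 * e z2 * c w1 * c w2) * (bessel_h \<alpha> (z1 * w1 / t) * bessel_h \<alpha> (z2 * w2 / t))"
      by (intro mult_left_mono bessel_h_TP2 \<alpha> that mult_nonneg_nonneg nonneg)
    then show ?thesis by (simp add: p ac_simps)
  qed
  consider "x' \<le> x" "y' \<le> y" | "x \<le> x'" "y \<le> y'" | "x' \<le> x" "y \<le> y'" | "x \<le> x'" "y' \<le> y"
    by linarith
  then show ?thesis
  proof cases
    case 3 then show ?thesis using cross[of x' x y y'] nn by (simp add: max_def min_def)
  next
    case 4 then show ?thesis using cross[of x x' y' y] nn by (auto simp add: max_def min_def mult.commute)
  qed (auto simp: max_def min_def mult.commute)
qed

text \<open>Every factor involves only two neighbouring positions, so the inequality is proved
  factor by factor. The entrance and exit data act as two further coordinates whose join and meet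
  are the given larger and smaller values; the denominators agree on both sides.\<close>

lemma bridge_ratio_TP2:
  assumes \<alpha>: "0 \<le> \<alpha>" and x: "0 \<le> x2" "x2 \<le> x1" and y: "0 \<le> y2" "y2 \<le> y1"
    and m: "1 \<le> m" and u: "\<forall>i\<in>{1..m}. 0 \<le> u i" and v: "\<forall>i\<in>{1..m}. 0 \<le> v i"
  shows "bridge_ratio \<alpha> T x1 y1 m t u * bridge_ratio \<alpha> T x2 y2 m t v
    \<le> bridge_ratio \<alpha> T x1 y1 m t (sup u v) * bridge_ratio \<alpha> T x2 y2 m t (inf u v)"
proof -
  define A where "A x z = bessel_p \<alpha> (t 1) x (z 1)" for x and z :: "nat \<Rightarrow> real"
  define B where "B z = (\<Prod>i\<in>{1..<m}. bessel_p \<alpha> (t (Suc i) - t i) (z i) (z (Suc i)))" for z :: "nat \<Rightarrow> real"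
  define C where "C y z = bessel_p \<alpha> (T - t m) (z m) y" for y and z :: "nat \<Rightarrow> real"
  have r: "bridge_ratio \<alpha> T x y m t z = A x z * B z * C y z / bessel_p \<alpha> T x y" for x y z
    by (simp add: bridge_ratio_def A_def B_def C_def)
  have nonneg: "0 \<le> A x z" "0 \<le> B z" "0 \<le> C y z" for x y z
    unfolding A_def B_def C_def by (auto intro!: prod_nonneg bessel_p_nonneg \<alpha>)
  have le: "bessel_p \<alpha> s p q * bessel_p \<alpha> s p' q'
      \<le> bessel_p \<alpha> s (sup p p') (sup q q') * bessel_p \<alpha> s (inf p p') (inf q q')"
    if "0 \<le> p" "0 \<le> q" "0 \<le> p'" "0 \<le> q'" for s p q p' q'
    using bessel_p_TP2[OF \<alpha> that] by (simp add: sup_max inf_min)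
  have "A x1 u * A x2 v \<le> A x1 (sup u v) * A x2 (inf u v)"
    using le[of x1 "u 1" x2 "v 1" "t 1"] x m u v by (simp add: A_def sup_absorb1 inf_absorb2)
  moreover have "B u * B v \<le> B (sup u v) * B (inf u v)"
    unfolding B_def prod.distrib[symmetric] using u v
    by (intro prod_mono conjI mult_nonneg_nonneg bessel_p_nonneg \<alpha>) (auto intro!: le)
  moreover have "C y1 u * C y2 v \<le> C y1 (sup u v) * C y2 (inf u v)"
    using le[of "u m" y1 "v m" y2 "T - t m"] y m u v by (simp add: C_def sup_absorb1 inf_absorb2)
  ultimately have "(A x1 u * A x2 v) * (B u * B v) * (C y1 u * C y2 v)
      \<le> (A x1 (sup u v) * A x2 (inf u v)) * (B (sup u v) * B (inf u v)) * (C y1 (sup u v) * C y2 (inf u v))"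
    by (meson mult_mono mult_nonneg_nonneg nonneg)
  then have "(A x1 u * A x2 v) * (B u * B v) * (C y1 u * C y2 v) / (bessel_p \<alpha> T x1 y1 * bessel_p \<alpha> T x2 y2)
      \<le> (A x1 (sup u v) * A x2 (inf u v)) * (B (sup u v) * B (inf u v)) * (C y1 (sup u v) * C y2 (inf u v))
        / (bessel_p \<alpha> T x1 y1 * bessel_p \<alpha> T x2 y2)"
    by (intro divide_right_mono mult_nonneg_nonneg bessel_p_nonneg \<alpha>)
  then show ?thesis by (simp add: r ac_simps)
qed

lemma bridge_ratio_nonneg: "0 \<le> \<alpha> \<Longrightarrow> 0 \<le> bridge_ratio \<alpha> T x y m t z"
  unfolding bridge_ratio_def
  by (intro divide_nonneg_nonneg mult_nonneg_nonneg prod_nonneg bessel_p_nonneg) auto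

lemma bridge_density_nonneg: "0 \<le> \<alpha> \<Longrightarrow> y \<noteq> 0 \<Longrightarrow> 0 \<le> bridge_density \<alpha> T x y m t z"
  by (simp add: bridge_density_def bridge_ratio_nonneg)

text \<open>Positive exit data select the branch without a limit. If u or v leaves the positive
  orthant the left side vanishes, and otherwise join and meet stay in the orthant.\<close>

lemma bridge_density_TP2:
  assumes \<alpha>: "0 \<le> \<alpha>" and x: "0 \<le> x2" "x2 \<le> x1" and y: "0 < y2" "y2 \<le> y1" and m: "1 \<le> m"
  shows "bridge_density \<alpha> T x1 y1 m t u * bridge_density \<alpha> T x2 y2 m t v
    \<le> bridge_density \<alpha> T x1 y1 m t (sup u v) * bridge_density \<alpha> T x2 y2 m t (inf u v)"
proof (cases "(\<forall>i\<in>{1..m}. 0 \<le> u i) \<and> (\<forall>i\<in>{1..m}. 0 \<le> v i)")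
  case True
  then have "\<forall>i\<in>{1..m}. 0 \<le> sup u v i" "\<forall>i\<in>{1..m}. 0 \<le> inf u v i"
    by (auto simp: le_supI1)
  with True y show ?thesis
    using bridge_ratio_TP2[OF \<alpha> x, of y2 y1 m u v T t] m by (simp add: bridge_density_def)
next
  case False
  then have "bridge_density \<alpha> T x1 y1 m t u * bridge_density \<alpha> T x2 y2 m t v = 0"
    by (auto simp: bridge_density_def)
  moreover have "0 \<le> bridge_density \<alpha> T x1 y1 m t (sup u v) * bridge_density \<alpha> T x2 y2 m t (inf u v)"
    using y by (intro mult_nonneg_nonneg bridge_density_nonneg[OF \<alpha>]) auto
  ultimately show ?thesis by linarith
qed

section \<open>Finite-dimensional distributions of the free ensemble\<close>

text \<open>The values of the unsquared bridges. Curves are the outer index and times the inner one,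
  so that independence of the curves makes the law a product of single-curve laws.\<close>

definition sqrt_vector :: "nat \<Rightarrow> nat \<Rightarrow> real \<Rightarrow> nat \<Rightarrow> (nat \<Rightarrow> real) \<Rightarrow> ensemble \<Rightarrow> nat \<Rightarrow> nat \<Rightarrow> real" where
  "sqrt_vector k1 k2 a m t \<omega> = (\<lambda>j\<in>{k1..k2}. \<lambda>i\<in>{1..m}. sqrt (\<omega> (j, a + t i)))"

lemma ensemble_eval_measurable:
  assumes "sets F = sets (ensemble_space k1 k2 a b)" "j \<in> {k1..k2}" "s \<in> {a..b}"
  shows "(\<lambda>\<omega>. \<omega> (j, s)) \<in> borel_measurable F"
proof -
  have "(\<lambda>\<omega>. \<omega> (j, s)) \<in> borel_measurable (ensemble_space k1 k2 a b)"
    unfolding ensemble_space_def using assms(2,3)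
    by (intro measurable_restrict_space1 measurable_component_singleton) auto
  then show ?thesis
    using measurable_cong_sets[OF assms(1) refl] by blast
qed

lemma times_in_range:
  fixes t :: "nat \<Rightarrow> real"
  assumes "0 < t 1" "strict_mono_on {1..m} t" "t m < T" "i \<in> {1..m}"
  shows "0 < t i" "t i < T"
proof -
  have "t 1 \<le> t i" "t i \<le> t m"
    using assms(2,4) by (auto intro!: strict_mono_on_leD[of "{1..m}" t])
  then show "0 < t i" "t i < T" using assms by auto
qed

text \<open>The curve is almost surely the square of some Bessel bridge \<open>S\<close>. The
  density of \<open>S\<close> vanishes off the positive orthant, so \<open>S\<close> is almost
  surely nonnegative at the sampled times and equals the square root of the curve there.\<close>

lemma sqrt_bridge_distributed:
  assumes fb: "free_bridge_law \<alpha> k1 k2 a b x y F" and j: "j \<in> {k1..k2}" and y: "0 < y j"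
    and t: "1 \<le> m" "0 < t 1" "strict_mono_on {1..m} t" "t m < b - a"
  shows "distributed F (\<Pi>\<^sub>M i\<in>{1..m}. lborel) (\<lambda>\<omega>. \<lambda>i\<in>{1..m}. sqrt (\<omega> (j, a + t i)))
    (\<lambda>z. ennreal (bridge_density \<alpha> (b - a) (sqrt (x j)) (sqrt (y j)) m t z))"
proof -
  interpret prob_space F using fb by (simp add: free_bridge_law_def)
  let ?N = "\<Pi>\<^sub>M i\<in>{1..m}. (lborel :: real measure)"
  let ?d = "\<lambda>z. ennreal (bridge_density \<alpha> (b - a) (sqrt (x j)) (sqrt (y j)) m t z)"
  let ?X = "\<lambda>\<omega> :: ensemble. \<lambda>i\<in>{1..m}. sqrt (\<omega> (j, a + t i))"
  have sets_F: "sets F = sets (ensemble_space k1 k2 a b)"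
    using fb by (simp add: free_bridge_law_def)
  obtain S where S: "bessel_bridge \<alpha> (b - a) (sqrt (x j)) (sqrt (y j)) F S"
    and J: "AE \<omega> in F. \<forall>s\<in>{0..b - a}. \<omega> (j, a + s) = (S s \<omega>)\<^sup>2"
    using fb j unfolding free_bridge_law_def squared_bessel_bridge_on_def squared_bessel_bridge_def by blast
  have dist: "distributed F ?N (\<lambda>\<omega>. \<lambda>i\<in>{1..m}. S (t i) \<omega>) ?d"
    using S t unfolding bessel_bridge_def by blast
  note range = times_in_range[OF t(2-4)]
  have X [measurable]: "?X \<in> F \<rightarrow>\<^sub>M ?N"
  proof (rule measurable_restrict)
    fix i assume "i \<in> {1..m}"
    with range[of i] j have [measurable]: "(\<lambda>\<omega>. \<omega> (j, a + t i)) \<in> borel_measurable F"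
      by (intro ensemble_eval_measurable[OF sets_F]) auto
    show "(\<lambda>\<omega>. sqrt (\<omega> (j, a + t i))) \<in> F \<rightarrow>\<^sub>M lborel"
      by measurable
  qed
  have "AE \<omega> in F. \<forall>i\<in>{1..m}. 0 \<le> (\<lambda>i\<in>{1..m}. S (t i) \<omega>) i"
  proof (subst distributed_AE2[OF dist])
    show "AE z in ?N. 0 < ?d z \<longrightarrow> (\<forall>i\<in>{1..m}. 0 \<le> z i)"
      using y by (auto simp: bridge_density_def split: if_splits)
  qed measurable
  with J have "AE \<omega> in F. (\<lambda>i\<in>{1..m}. S (t i) \<omega>) = ?X \<omega>"
  proof eventually_elim
    case (elim \<omega>)
    then show ?case
      using range by (intro restrict_ext) (auto simp: less_imp_le)
  qed
  then have "distr F ?N (\<lambda>\<omega>. \<lambda>i\<in>{1..m}. S (t i) \<omega>) = distr F ?N ?X"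
    using dist X by (intro distr_cong_AE) (simp_all only: distributed_def)
  then show ?thesis using dist X by (simp only: distributed_def)
qed

lemma sqrt_vector_law:
  assumes fb: "free_bridge_law \<alpha> k1 k2 a b x y F" and k: "k1 \<le> k2" and y: "\<forall>j\<in>{k1..k2}. 0 < y j"
    and t: "1 \<le> m" "0 < t 1" "strict_mono_on {1..m} t" "t m < b - a"
  shows "sqrt_vector k1 k2 a m t \<in> F \<rightarrow>\<^sub>M (\<Pi>\<^sub>M j\<in>{k1..k2}. \<Pi>\<^sub>M i\<in>{1..m}. lborel)"
    and "distr F (\<Pi>\<^sub>M j\<in>{k1..k2}. \<Pi>\<^sub>M i\<in>{1..m}. lborel) (sqrt_vector k1 k2 a m t) =
      (\<Pi>\<^sub>M j\<in>{k1..k2}. density (\<Pi>\<^sub>M i\<in>{1..m}. lborel)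
        (\<lambda>z. ennreal (bridge_density \<alpha> (b - a) (sqrt (x j)) (sqrt (y j)) m t z)))"
proof -
  interpret prob_space F using fb by (simp add: free_bridge_law_def)
  let ?N = "\<Pi>\<^sub>M i\<in>{1..m}. (lborel :: real measure)"
  let ?X = "\<lambda>j (\<omega> :: ensemble). \<lambda>i\<in>{1..m}. sqrt (\<omega> (j, a + t i))"
  have dist: "distributed F ?N (?X j)
      (\<lambda>z. ennreal (bridge_density \<alpha> (b - a) (sqrt (x j)) (sqrt (y j)) m t z))" if "j \<in> {k1..k2}" for j
    using sqrt_bridge_distributed[OF fb that _ t] y that by blast
  have X [measurable]: "?X j \<in> F \<rightarrow>\<^sub>M ?N" if "j \<in> {k1..k2}" for j
    using dist[OF that] by (simp add: distributed_def)
  have V: "sqrt_vector k1 k2 a m t = (\<lambda>\<omega>. \<lambda>j\<in>{k1..k2}. ?X j \<omega>)"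
    by (simp add: sqrt_vector_def fun_eq_iff)
  show "sqrt_vector k1 k2 a m t \<in> F \<rightarrow>\<^sub>M (\<Pi>\<^sub>M j\<in>{k1..k2}. ?N)"
    unfolding V by (intro measurable_restrict X)
  note range = times_in_range[OF t(2-4)]
  \<comment> \<open>Independence is given for whole paths; \<open>R\<close> reads the sampled vector
    off a path, so independence is inherited by the samples.\<close>
  define R where "R p = (\<lambda>i\<in>{1..m}. sqrt (p (a + t i)))" for p :: "real \<Rightarrow> real"
  have R: "R \<in> (\<Pi>\<^sub>M s\<in>{a..b}. borel) \<rightarrow>\<^sub>M ?N"
    unfolding R_def
  proof (rule measurable_restrict)
    fix i assume "i \<in> {1..m}"
    with range[of i] have [measurable]: "(\<lambda>p. p (a + t i)) \<in> borel_measurable (\<Pi>\<^sub>M s\<in>{a..b}. borel)"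
      by (intro measurable_component_singleton) auto
    show "(\<lambda>p. sqrt (p (a + t i))) \<in> (\<Pi>\<^sub>M s\<in>{a..b}. borel) \<rightarrow>\<^sub>M lborel" by measurable
  qed
  have "indep_vars (\<lambda>j. \<Pi>\<^sub>M s\<in>{a..b}. borel) (\<lambda>j \<omega>. \<lambda>s\<in>{a..b}. \<omega> (j, s)) {k1..k2}"
    using fb by (simp add: free_bridge_law_def)
  then have "indep_vars (\<lambda>_. ?N) (\<lambda>j \<omega>. R (\<lambda>s\<in>{a..b}. \<omega> (j, s))) {k1..k2}"
    by (rule indep_vars_compose2) (rule R)
  moreover have RX: "(\<lambda>j \<omega>. R (\<lambda>s\<in>{a..b}. \<omega> (j, s))) = ?X"
    unfolding R_def
  proof (rule ext, rule ext, rule restrict_ext)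
    fix j and \<omega> :: ensemble
    fix i assume "i \<in> {1..m}"
    with range[of i] have "a + t i \<in> {a..b}" by auto
    then show "sqrt ((\<lambda>s\<in>{a..b}. \<omega> (j, s)) (a + t i)) = sqrt (\<omega> (j, a + t i))" by simp
  qed
  ultimately have "indep_vars (\<lambda>_. ?N) ?X {k1..k2}" by (simp only:)
  then have "distr F (\<Pi>\<^sub>M j\<in>{k1..k2}. ?N) (\<lambda>\<omega>. \<lambda>j\<in>{k1..k2}. ?X j \<omega>) = (\<Pi>\<^sub>M j\<in>{k1..k2}. distr F ?N (?X j))"
    by (rule indep_vars_iff_distr_eq_PiM'[THEN iffD1, rotated 2]) (use k X in \<open>simp_all only: atLeastatMost_empty_iff not_not\<close>)
  also have "\<dots> = (\<Pi>\<^sub>M j\<in>{k1..k2}. density ?N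
      (\<lambda>z. ennreal (bridge_density \<alpha> (b - a) (sqrt (x j)) (sqrt (y j)) m t z)))"
    using dist by (intro PiM_cong) (auto simp: distributed_def)
  finally show "distr F (\<Pi>\<^sub>M j\<in>{k1..k2}. ?N) (sqrt_vector k1 k2 a m t) = \<dots>"
    unfolding V .
qed

lemma four_functions_sqrt_vector:
  assumes \<alpha>: "0 \<le> \<alpha>" and k: "k1 \<le> k2"
    and fb1: "free_bridge_law \<alpha> k1 k2 a b x1 y1 F1" and fb2: "free_bridge_law \<alpha> k1 k2 a b x2 y2 F2"
    and x: "\<forall>j\<in>{k1..k2}. 0 \<le> x2 j \<and> x2 j \<le> x1 j" and y: "\<forall>j\<in>{k1..k2}. 0 < y2 j \<and> y2 j \<le> y1 j"
    and t: "1 \<le> m" "0 < t 1" "strict_mono_on {1..m} t" "t m < b - a"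
  shows "four_functions
    (distr F1 (\<Pi>\<^sub>M j\<in>{k1..k2}. \<Pi>\<^sub>M i\<in>{1..m}. lborel) (sqrt_vector k1 k2 a m t))
    (distr F2 (\<Pi>\<^sub>M j\<in>{k1..k2}. \<Pi>\<^sub>M i\<in>{1..m}. lborel) (sqrt_vector k1 k2 a m t))"
proof -
  let ?N = "\<Pi>\<^sub>M i\<in>{1..m}. (lborel :: real measure)"
  have y1: "\<forall>j\<in>{k1..k2}. 0 < y1 j" and y2: "\<forall>j\<in>{k1..k2}. 0 < y2 j" using y by fastforce+
  \<comment> \<open>The density integrates to 1 because it belongs to the law of a sampled curve; no
    normalization has to be computed.\<close>
  have sf: "sigma_finite_measure (density ?N
      (\<lambda>z. ennreal (bridge_density \<alpha> (b - a) (sqrt (x j)) (sqrt (y j)) m t z)))"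
    if fb: "free_bridge_law \<alpha> k1 k2 a b x y F" and "0 < y j" "j \<in> {k1..k2}" for x y F j
  proof -
    interpret prob_space F using fb by (simp add: free_bridge_law_def)
    have d: "distributed F ?N (\<lambda>\<omega>. \<lambda>i\<in>{1..m}. sqrt (\<omega> (j, a + t i)))
        (\<lambda>z. ennreal (bridge_density \<alpha> (b - a) (sqrt (x j)) (sqrt (y j)) m t z))"
      using sqrt_bridge_distributed[OF fb that(3,2) t] .
    have "prob_space (distr F ?N (\<lambda>\<omega>. \<lambda>i\<in>{1..m}. sqrt (\<omega> (j, a + t i))))"
      using d by (intro prob_space_distr) (simp add: distributed_def)
    then show ?thesis
      using d by (simp add: distributed_def prob_space_imp_sigma_finite)
  qed
  have meas: "(\<lambda>z. ennreal (bridge_density \<alpha> (b - a) (sqrt (x j)) (sqrt (y j)) m t z)) \<in> borel_measurable ?N"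
    if fb: "free_bridge_law \<alpha> k1 k2 a b x y F" and "0 < y j" "j \<in> {k1..k2}" for x y F j
    using sqrt_bridge_distributed[OF fb that(3,2) t] by (simp add: distributed_def)
  show ?thesis
    unfolding sqrt_vector_law(2)[OF fb1 k y1 t] sqrt_vector_law(2)[OF fb2 k y2 t]
  proof (rule four_functions_PiM)
    fix j assume j: "j \<in> {k1..k2}"
    show "sigma_finite_measure (density ?N
        (\<lambda>z. ennreal (bridge_density \<alpha> (b - a) (sqrt (x1 j)) (sqrt (y1 j)) m t z)))"
      using sf[OF fb1] y1 j by blast
    show "sigma_finite_measure (density ?N
        (\<lambda>z. ennreal (bridge_density \<alpha> (b - a) (sqrt (x2 j)) (sqrt (y2 j)) m t z)))"
      using sf[OF fb2] y2 j by blast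
    show "four_functions
        (density ?N (\<lambda>z. ennreal (bridge_density \<alpha> (b - a) (sqrt (x1 j)) (sqrt (y1 j)) m t z)))
        (density ?N (\<lambda>z. ennreal (bridge_density \<alpha> (b - a) (sqrt (x2 j)) (sqrt (y2 j)) m t z)))"
    proof (rule four_functions_density)
      show "four_functions ?N ?N"
        by (intro four_functions_PiM four_functions_lborel sigma_finite_lborel) simp
      show "(\<lambda>z. ennreal (bridge_density \<alpha> (b - a) (sqrt (x1 j)) (sqrt (y1 j)) m t z)) \<in> borel_measurable ?N"
        using meas[OF fb1] y1 j by blast
      show "(\<lambda>z. ennreal (bridge_density \<alpha> (b - a) (sqrt (x2 j)) (sqrt (y2 j)) m t z)) \<in> borel_measurable ?N"
        using meas[OF fb2] y2 j by blast
      fix u v :: "nat \<Rightarrow> real"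
      show "ennreal (bridge_density \<alpha> (b - a) (sqrt (x1 j)) (sqrt (y1 j)) m t u) *
          ennreal (bridge_density \<alpha> (b - a) (sqrt (x2 j)) (sqrt (y2 j)) m t v)
        \<le> ennreal (bridge_density \<alpha> (b - a) (sqrt (x1 j)) (sqrt (y1 j)) m t (sup u v)) *
          ennreal (bridge_density \<alpha> (b - a) (sqrt (x2 j)) (sqrt (y2 j)) m t (inf u v))"
        using bridge_density_TP2[OF \<alpha>, of "sqrt (x2 j)" "sqrt (x1 j)" "sqrt (y2 j)" "sqrt (y1 j)" m "b - a" t u v]
          x y y1 j t(1)
        by (simp add: ennreal_mult'[symmetric] bridge_density_nonneg[OF \<alpha>] ennreal_leI less_imp_neq[symmetric])
    qed
  qed simp
qed

text \<open>The inverse of \<open>sqrt\<close> on the whole line, the real \<open>sqrt\<close> being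
  odd. Paths with negative values belong to the path space as well, and with this inverse the
  sampled values are recovered for every path and not just almost surely.\<close>

definition signed_square :: "real \<Rightarrow> real" where
  "signed_square x = x * \<bar>x\<bar>"

lemma signed_square_sqrt [simp]: "signed_square (sqrt x) = x"
  by (cases "0 \<le> x") (simp_all add: signed_square_def abs_of_neg)

lemma mono_signed_square: "mono signed_square"
proof (rule monoI)
  fix x y :: real assume "x \<le> y"
  consider "0 \<le> x" | "x \<le> 0" "0 \<le> y" | "y \<le> 0" by linarith
  then show "signed_square x \<le> signed_square y"
  proof cases
    case 1 then show ?thesis using \<open>x \<le> y\<close> by (simp add: signed_square_def mult_mono)
  next
    case 2
    then have "x * \<bar>x\<bar> \<le> 0" "0 \<le> y * \<bar>y\<bar>" by (auto intro: mult_nonpos_nonneg)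
    then show ?thesis by (simp add: signed_square_def)
  next
    case 3
    then have "(- y) * (- y) \<le> (- x) * (- x)" using \<open>x \<le> y\<close> by (intro mult_mono) auto
    then show ?thesis using 3 \<open>x \<le> y\<close> by (simp add: signed_square_def)
  qed
qed

lemma signed_square_sup: "signed_square (sup x y) = sup (signed_square x) (signed_square y)"
  and signed_square_inf: "signed_square (inf x y) = inf (signed_square x) (signed_square y)"
  using mono_signed_square[THEN monoD, of x y] mono_signed_square[THEN monoD, of y x]
  by (cases "x \<le> y"; simp add: sup_absorb1 sup_absorb2 inf_absorb1 inf_absorb2)+

lemma ex_increasing_enumeration:
  fixes T :: "real set"
  assumes "finite T" "T \<noteq> {}"
  obtains m :: nat and t where "1 \<le> m" "strict_mono_on {1..m} t" "t ` {1..m} = T"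
proof -
  let ?xs = "sorted_list_of_set T"
  \<comment> \<open>Times are numbered from 1, list positions from 0.\<close>
  define t where "t i = ?xs ! (i - 1)" for i
  have len: "length ?xs = card T" by simp
  have "1 \<le> card T" using assms by (simp add: Suc_leI card_gt_0_iff)
  moreover have "strict_mono_on {1..card T} t"
  proof (rule strict_mono_onI)
    fix r s assume "r \<in> {1..card T}" "s \<in> {1..card T}" "r < s"
    then show "t r < t s"
      unfolding t_def using sorted_wrt_nth_less[OF strict_sorted_list_of_set, of "r - 1" "s - 1" T] by auto
  qed
  moreover have "t ` {1..card T} = T"
  proof -
    have "T = set ?xs" using assms by simp
    also have "\<dots> = (\<lambda>i. ?xs ! i) ` {..<card T}" by (auto simp: set_conv_nth)
    also have "\<dots> = t ` {1..card T}"
    proof -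
      have "{1..card T} = Suc ` {..<card T}" by (simp add: lessThan_atLeast0 image_Suc_atLeastLessThan atLeastLessThanSuc_atLeastAtMost)
      then show ?thesis by (simp add: t_def image_image)
    qed
    finally show ?thesis by simp
  qed
  ultimately show thesis using that by blast
qed

text \<open>Passing to square roots, which is a lattice isomorphism of the real line, reduces the claim to the
  density of the Bessel bridges.\<close>

lemma free_bridge_lattice_inequality:
  assumes \<alpha>: "0 \<le> \<alpha>" and k: "k1 \<le> k2"
    and fb1: "free_bridge_law \<alpha> k1 k2 a b x1 y1 F1" and fb2: "free_bridge_law \<alpha> k1 k2 a b x2 y2 F2"
    and x: "\<forall>j\<in>{k1..k2}. 0 \<le> x2 j \<and> x2 j \<le> x1 j" and y: "\<forall>j\<in>{k1..k2}. 0 < y2 j \<and> y2 j \<le> y1 j"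
    and T: "finite T" "T \<noteq> {}" "T \<subseteq> {a<..<b}"
    and dep: "\<And>i \<omega>. P i (restrict \<omega> ({k1..k2} \<times> T)) = P i \<omega>"
    and meas: "\<And>i. Measurable.pred (\<Pi>\<^sub>M p\<in>{k1..k2} \<times> T. borel) (P i)"
    and lat: "\<And>\<omega> \<eta>. P 1 \<omega> \<Longrightarrow> P 2 \<eta> \<Longrightarrow> P 3 (sup \<omega> \<eta>) \<and> P (4::nat) (inf \<omega> \<eta>)"
  shows "measure F1 {\<omega>\<in>space F1. P 1 \<omega>} * measure F2 {\<omega>\<in>space F2. P 2 \<omega>}
    \<le> measure F1 {\<omega>\<in>space F1. P 3 \<omega>} * measure F2 {\<omega>\<in>space F2. P 4 \<omega>}"
proof -
  interpret F1: prob_space F1 using fb1 by (simp add: free_bridge_law_def)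
  interpret F2: prob_space F2 using fb2 by (simp add: free_bridge_law_def)
  have y1: "\<forall>j\<in>{k1..k2}. 0 < y1 j" and y2: "\<forall>j\<in>{k1..k2}. 0 < y2 j" using y by fastforce+
  obtain m :: nat and s :: "nat \<Rightarrow> real" where m: "1 \<le> m" and s: "strict_mono_on {1..m} s" "s ` {1..m} = T"
    by (rule ex_increasing_enumeration[OF T(1,2)])
  define t where "t i = s i - a" for i
  have "s 1 \<in> T" "s m \<in> T"
    unfolding s(2)[symmetric] using m by (auto intro!: imageI)
  then have t: "1 \<le> m" "0 < t 1" "strict_mono_on {1..m} t" "t m < b - a"
    using m s(1) T(3) by (auto simp: t_def strict_mono_on_def)
  define idx where "idx = inv_into {1..m} s"
  have idx: "idx r \<in> {1..m}" "a + t (idx r) = r" if "r \<in> T" for r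
    using that s(2) inv_into_into[of r s "{1..m}"] f_inv_into_f[of r s "{1..m}"] by (simp_all add: idx_def t_def)
  define N where "N = (\<Pi>\<^sub>M j\<in>{k1..k2}. \<Pi>\<^sub>M i\<in>{1..m}. (lborel :: real measure))"
  note ff = four_functions_sqrt_vector[OF \<alpha> k fb1 fb2 x y t, folded N_def]
  let ?V = "sqrt_vector k1 k2 a m t"
  \<comment> \<open>Turns a vector of square roots back into an ensemble on the grid,
    \<open>idx\<close> being the inverse of the enumeration of times. Off the grid its values are
    arbitrary, which is harmless because by \<open>dep\<close> the predicates see only the
    grid.\<close>
  define Q where "Q v = (\<lambda>(j, r). signed_square (v j (idx r)))" for v :: "nat \<Rightarrow> nat \<Rightarrow> real"
  have Q_sup: "Q (sup u v) = sup (Q u) (Q v)" and Q_inf: "Q (inf u v) = inf (Q u) (Q v)" for u v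
    by (auto simp: Q_def fun_eq_iff signed_square_sup signed_square_inf)
  have "(\<lambda>v. restrict (Q v) ({k1..k2} \<times> T)) \<in> N \<rightarrow>\<^sub>M (\<Pi>\<^sub>M p\<in>{k1..k2} \<times> T. borel)"
  proof (rule measurable_restrict)
    fix p assume "p \<in> {k1..k2} \<times> T"
    then obtain j r where p: "p = (j, r)" "j \<in> {k1..k2}" "r \<in> T" by auto
    have [measurable]: "(\<lambda>v. v j (idx r)) \<in> borel_measurable N"
    proof -
      have "(\<lambda>v. v j) \<in> N \<rightarrow>\<^sub>M (\<Pi>\<^sub>M i\<in>{1..m}. lborel)"
        unfolding N_def using p by (intro measurable_component_singleton)
      from measurable_compose[OF this measurable_component_singleton[OF idx(1)[OF p(3)]]]
      show ?thesis by simp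
    qed
    show "(\<lambda>v. Q v p) \<in> borel_measurable N"
      unfolding Q_def p(1) signed_square_def case_prod_conv by measurable
  qed
  from measurable_compose[OF this meas]
  have W [measurable]: "Measurable.pred N (\<lambda>v. P i (Q v))" for i
    by (simp add: dep)
  have PV: "P i (Q (?V \<omega>)) = P i \<omega>" for i \<omega>
  proof -
    have "restrict (Q (?V \<omega>)) ({k1..k2} \<times> T) = restrict \<omega> ({k1..k2} \<times> T)"
      using idx by (intro restrict_ext) (auto simp: Q_def sqrt_vector_def)
    then show ?thesis using dep[of i "Q (?V \<omega>)"] dep[of i \<omega>] by simp
  qed
  note V1 [measurable] = sqrt_vector_law(1)[OF fb1 k y1 t, folded N_def]
  note V2 [measurable] = sqrt_vector_law(1)[OF fb2 k y2 t, folded N_def]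
  let ?I = "\<lambda>i v. indicator {v \<in> space N. P i (Q v)} v :: ennreal"
  have le: "(\<integral>\<^sup>+v. ?I 1 v \<partial>distr F1 N ?V) * (\<integral>\<^sup>+v. ?I 2 v \<partial>distr F2 N ?V)
      \<le> (\<integral>\<^sup>+v. ?I 3 v \<partial>distr F1 N ?V) * (\<integral>\<^sup>+v. ?I 4 v \<partial>distr F2 N ?V)"
  proof (rule four_functionsD[OF ff])
    fix u v assume uv: "u \<in> space (distr F1 N ?V)" "v \<in> space (distr F1 N ?V)"
    then have "sup u v \<in> space N" "inf u v \<in> space N"
      using four_functions_space[OF ff uv] by simp_all
    then show "?I 1 u * ?I 2 v \<le> ?I 3 (sup u v) * ?I 4 (inf u v)"
      using lat[of "Q u" "Q v"] by (auto simp: indicator_def Q_sup Q_inf)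
  qed simp_all
  have 1: "(\<integral>\<^sup>+v. ?I i v \<partial>distr F1 N ?V) = ennreal (measure F1 {\<omega>\<in>space F1. P i \<omega>})" for i
  proof -
    have "(\<integral>\<^sup>+v. ?I i v \<partial>distr F1 N ?V) = emeasure (distr F1 N ?V) {v \<in> space N. P i (Q v)}"
      by (intro nn_integral_indicator) simp
    also have "\<dots> = emeasure F1 {\<omega>\<in>space F1. P i \<omega>}"
      using measurable_space[OF V1]
      by (subst emeasure_distr) (auto simp: PV intro!: arg_cong2[where f = emeasure])
    finally show ?thesis by (simp add: F1.emeasure_eq_measure)
  qed
  have 2: "(\<integral>\<^sup>+v. ?I i v \<partial>distr F2 N ?V) = ennreal (measure F2 {\<omega>\<in>space F2. P i \<omega>})" for i
  proof -
    have "(\<integral>\<^sup>+v. ?I i v \<partial>distr F2 N ?V) = emeasure (distr F2 N ?V) {v \<in> space N. P i (Q v)}"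
      by (intro nn_integral_indicator) simp
    also have "\<dots> = emeasure F2 {\<omega>\<in>space F2. P i \<omega>}"
      using measurable_space[OF V2]
      by (subst emeasure_distr) (auto simp: PV intro!: arg_cong2[where f = emeasure])
    finally show ?thesis by (simp add: F2.emeasure_eq_measure)
  qed
  show ?thesis
    using le unfolding 1 2 by (simp add: ennreal_mult'[symmetric])
qed

section \<open>Non-intersection at rational times\<close>

abbreviation rational_times :: "real \<Rightarrow> real \<Rightarrow> real set" where
  "rational_times a b \<equiv> \<rat> \<inter> {a<..<b}"

lemma ex_rational_approach:
  assumes "a < b" "t \<in> {a..b}"
  shows "a < t \<Longrightarrow> at t within (rational_times a b \<inter> {..<t}) \<noteq> bot"
    and "t < b \<Longrightarrow> at t within (rational_times a b \<inter> {t<..}) \<noteq> bot"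
proof -
  assume "a < t"
  have "\<exists>r\<in>rational_times a b \<inter> {..<t}. r \<noteq> t \<and> dist r t < \<epsilon>" if "\<epsilon> > 0" for \<epsilon>
  proof -
    obtain r where "r \<in> \<rat>" "max a (t - \<epsilon>) < r" "r < t"
      using Rats_dense_in_real[of "max a (t - \<epsilon>)" t] \<open>a < t\<close> \<open>\<epsilon> > 0\<close> by auto
    then show ?thesis using assms by (intro bexI[of _ r]) (auto simp: dist_real_def)
  qed
  then show "at t within (rational_times a b \<inter> {..<t}) \<noteq> bot"
    unfolding trivial_limit_within islimpt_approachable by blast
next
  assume "t < b"
  have "\<exists>r\<in>rational_times a b \<inter> {t<..}. r \<noteq> t \<and> dist r t < \<epsilon>" if "\<epsilon> > 0" for \<epsilon>
  proof -
    obtain r where "r \<in> \<rat>" "t < r" "r < min b (t + \<epsilon>)"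
      using Rats_dense_in_real[of t "min b (t + \<epsilon>)"] \<open>t < b\<close> \<open>\<epsilon> > 0\<close> by auto
    then show ?thesis using assms by (intro bexI[of _ r]) (auto simp: dist_real_def)
  qed
  then show "at t within (rational_times a b \<inter> {t<..}) \<noteq> bot"
    unfolding trivial_limit_within islimpt_approachable by blast
qed

text \<open>Rational times on one side of t suffice: the side from which h is continuous or, at a
  and b, the only side inside the interval.\<close>

lemma ex_approach_filter:
  fixes h :: "real \<Rightarrow> 'b::t2_space"
  assumes ab: "a < b" and t: "t \<in> {a..b}"
    and ends: "\<forall>s\<in>{a, b}. continuous (at s within {a..b}) h"
    and inner: "\<forall>s\<in>{a<..<b}. one_sided_continuous_at h s"
  obtains F where "F \<noteq> bot" "F \<le> at t within {a..b}" "eventually (\<lambda>s. s \<in> rational_times a b) F"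
    "(h \<longlongrightarrow> h t) F"
proof -
  let ?L = "at t within (rational_times a b \<inter> {..<t})"
  let ?R = "at t within (rational_times a b \<inter> {t<..})"
  have ev: "eventually (\<lambda>s. s \<in> rational_times a b) ?L" "eventually (\<lambda>s. s \<in> rational_times a b) ?R"
    by (auto simp: eventually_at_filter)
  have sub: "?L \<le> at t within {a..b}" "?R \<le> at t within {a..b}"
    by (auto intro!: at_le)
  have sub': "?L \<le> at_left t" "?R \<le> at_right t"
    by (auto intro!: at_le)
  consider "t = a" | "t = b" | "a < t" "t < b" "continuous (at_left t) h" | "a < t" "t < b" "continuous (at_right t) h"
    using t inner unfolding one_sided_continuous_at_def by force
  then show thesis
  proof cases
    case 1
    then have "(h \<longlongrightarrow> h t) (at t within {a..b})" using ends by (simp add: continuous_within)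
    then show thesis
      using that[of ?R] ex_rational_approach(2)[OF ab t] ev sub tendsto_mono 1 ab by blast
  next
    case 2
    then have "(h \<longlongrightarrow> h t) (at t within {a..b})" using ends by (simp add: continuous_within)
    then show thesis
      using that[of ?L] ex_rational_approach(1)[OF ab t] ev sub tendsto_mono 2 ab by blast
  next
    case 3
    then have "(h \<longlongrightarrow> h t) (at_left t)" by (simp add: continuous_within)
    then show thesis
      using that[of ?L] ex_rational_approach(1)[OF ab t] ev sub sub' tendsto_mono 3 by blast
  next
    case 4
    then have "(h \<longlongrightarrow> h t) (at_right t)" by (simp add: continuous_within)
    then show thesis
      using that[of ?R] ex_rational_approach(2)[OF ab t] ev sub sub' tendsto_mono 4 by blast
  qed
qed

text \<open>Weak inequalities with a common gap: a condition that is closed under limits and becomes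
  stronger as \<open>e\<close> grows. An infinite upper boundary imposes nothing.\<close>

definition margin_at ::
  "nat \<Rightarrow> nat \<Rightarrow> (real \<Rightarrow> real) \<Rightarrow> (real \<Rightarrow> ereal) \<Rightarrow> real \<Rightarrow> ensemble \<Rightarrow> real \<Rightarrow> bool" where
  "margin_at k1 k2 f g e \<omega> s \<longleftrightarrow>
     f s + e \<le> \<omega> (k1, s) \<and> (\<forall>j\<in>{k1..<k2}. \<omega> (j, s) + e \<le> \<omega> (Suc j, s)) \<and> ereal (\<omega> (k2, s) + e) \<le> g s"

lemma margin_at_mono: "margin_at k1 k2 f g e \<omega> s \<Longrightarrow> e' \<le> e \<Longrightarrow> margin_at k1 k2 f g e' \<omega> s"
proof -
  assume m: "margin_at k1 k2 f g e \<omega> s" and "e' \<le> e"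
  then have "ereal (\<omega> (k2, s) + e') \<le> ereal (\<omega> (k2, s) + e)" by simp
  also have "\<dots> \<le> g s" using m by (simp add: margin_at_def)
  finally show ?thesis using m \<open>e' \<le> e\<close> unfolding margin_at_def by fastforce
qed

lemma continuous_on_slice:
  assumes "continuous_on (K \<times> S) (\<omega> :: 'a::topological_space \<times> 'b::topological_space \<Rightarrow> 'c::topological_space)" "j \<in> K"
  shows "continuous_on S (\<lambda>s. \<omega> (j, s))"
  by (rule continuous_on_compose2[OF assms(1)]) (use assms(2) in \<open>auto intro!: continuous_intros\<close>)

text \<open>Each t is approached through rational times along which the boundary tends to its value
  at t, and weak inequalities survive. Semicontinuity points the wrong way here: an upper
  semi-continuous f may jump up at a single irrational time, which one-sided continuity
  excludes.\<close>

lemma margin_at_rational_times_imp: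
  assumes ab: "a < b" and k: "k1 \<le> k2" and ca: "continuity_assumption a b f g"
    and \<omega>: "continuous_on ({k1..k2} \<times> {a..b}) \<omega>"
    and D: "\<forall>s\<in>rational_times a b. margin_at k1 k2 f g e \<omega> s" and t: "t \<in> {a..b}"
  shows "margin_at k1 k2 f g e \<omega> t"
  unfolding margin_at_def
proof (intro conjI ballI)
  have lim: "((\<lambda>s. \<omega> (j, s)) \<longlongrightarrow> \<omega> (j, t)) F" if "j \<in> {k1..k2}" "F \<le> at t within {a..b}" for j F
    using continuous_on_slice[OF \<omega> that(1)] t that(2) unfolding continuous_on_def by (blast intro: tendsto_mono)
  have f: "\<forall>s\<in>{a, b}. continuous (at s within {a..b}) f" "\<forall>s\<in>{a<..<b}. one_sided_continuous_at f s"
    and g: "\<forall>s\<in>{a, b}. continuous (at s within {a..b}) g" "\<forall>s\<in>{a<..<b}. one_sided_continuous_at g s"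
    using ca by (simp_all add: continuity_assumption_def)
  obtain F where F: "F \<noteq> bot" "F \<le> at t within {a..b}" "eventually (\<lambda>s. s \<in> rational_times a b) F" "(f \<longlongrightarrow> f t) F"
    using ex_approach_filter[OF ab t f] by blast
  have "eventually (\<lambda>s. f s + e \<le> \<omega> (k1, s)) F"
    using F(3) by eventually_elim (use D in \<open>simp add: margin_at_def\<close>)
  then show "f t + e \<le> \<omega> (k1, t)"
    using F k by (intro tendsto_le[OF F(1) lim tendsto_add[OF F(4) tendsto_const]]) auto
  have "eventually (\<lambda>s. \<omega> (j, s) + e \<le> \<omega> (Suc j, s)) F" if "j \<in> {k1..<k2}" for j
    using F(3) by eventually_elim (use D that in \<open>simp add: margin_at_def\<close>)
  then show "\<omega> (j, t) + e \<le> \<omega> (Suc j, t)" if "j \<in> {k1..<k2}" for j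
    using F that by (intro tendsto_le[OF F(1) lim tendsto_add[OF lim tendsto_const]]) auto
  \<comment> \<open>A second filter is chosen because f and g may be continuous from opposite sides
    at t.\<close>
  obtain G where G: "G \<noteq> bot" "G \<le> at t within {a..b}" "eventually (\<lambda>s. s \<in> rational_times a b) G" "(g \<longlongrightarrow> g t) G"
    using ex_approach_filter[OF ab t g] by blast
  have "eventually (\<lambda>s. ereal (\<omega> (k2, s) + e) \<le> g s) G"
    using G(3) by eventually_elim (use D in \<open>simp add: margin_at_def\<close>)
  then show "ereal (\<omega> (k2, t) + e) \<le> g t"
    using G k by (intro tendsto_le[OF G(1) G(4) tendsto_ereal[OF tendsto_add[OF lim tendsto_const]]]) auto
qed

text \<open>Compactness of the interval in the form of Bolzano's bisection: a gap on each of two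
  adjacent pieces gives the smaller gap on their union. \<open>Q e t\<close> is demanded separately
  since the filter at t omits t itself.\<close>

lemma uniform_margin:
  fixes Q :: "real \<Rightarrow> real \<Rightarrow> bool"
  assumes ab: "a \<le> b"
    and anti: "\<And>e e' s. Q e s \<Longrightarrow> e' \<le> e \<Longrightarrow> Q e' s"
    and near: "\<And>t. t \<in> {a..b} \<Longrightarrow> \<exists>e>0. Q e t \<and> (\<forall>\<^sub>F s in at t within {a..b}. Q e s)"
  shows "\<forall>\<^sub>F N in sequentially. \<forall>s\<in>{a..b}. Q (1 / real (Suc N)) s"
proof -
  have "\<exists>e>0. \<forall>s\<in>{a..b} \<inter> {a..b}. Q e s"
    using ab
  proof (rule Bolzano[where P = "\<lambda>p q. \<exists>e>0. \<forall>s\<in>{p..q} \<inter> {a..b}. Q e s"])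
    fix p q r assume "\<exists>e>0. \<forall>s\<in>{p..q} \<inter> {a..b}. Q e s" "\<exists>e>0. \<forall>s\<in>{q..r} \<inter> {a..b}. Q e s"
    then obtain e e' where e: "e > 0" "e' > 0" "\<forall>s\<in>{p..q} \<inter> {a..b}. Q e s" "\<forall>s\<in>{q..r} \<inter> {a..b}. Q e' s"
      by blast
    then have "\<forall>s\<in>{p..r} \<inter> {a..b}. Q (min e e') s"
      using anti[of e _ "min e e'"] anti[of e' _ "min e e'"] by (metis Int_iff atLeastAtMost_iff linear min.cobounded1 min.cobounded2)
    then show "\<exists>e>0. \<forall>s\<in>{p..r} \<inter> {a..b}. Q e s" using e by (intro exI[of _ "min e e'"]) auto
  next
    fix t assume "a \<le> t" "t \<le> b"
    then obtain e d where e: "e > 0" "Q e t" "d > 0" "\<forall>s\<in>{a..b}. s \<noteq> t \<and> dist s t < d \<longrightarrow> Q e s"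
      using near[of t] unfolding eventually_at by auto
    have "\<exists>e>0. \<forall>s\<in>{p..q} \<inter> {a..b}. Q e s" if "p \<le> t" "t \<le> q" "q - p < d" for p q
    proof (intro exI conjI ballI)
      fix s assume s: "s \<in> {p..q} \<inter> {a..b}"
      then have "dist s t < d" using that by (auto simp: dist_real_def)
      then show "Q e s" using e s by (cases "s = t") auto
    qed fact
    then show "\<exists>d>0. \<forall>p q. p \<le> t \<and> t \<le> q \<and> q - p < d \<longrightarrow> (\<exists>e>0. \<forall>s\<in>{p..q} \<inter> {a..b}. Q e s)"
      using e(3) by blast
  qed
  then obtain e where e: "e > 0" "\<forall>s\<in>{a..b}. Q e s" by auto
  obtain M where M: "1 / real (Suc M) < e" using e(1) nat_approx_posE by metis
  show ?thesis
    unfolding eventually_sequentially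
  proof (intro exI[of _ M] allI impI ballI)
    fix N s assume "M \<le> N" "s \<in> {a..b}"
    then have "1 / real (Suc N) \<le> 1 / real (Suc M)" by (intro divide_left_mono) auto
    then show "Q (1 / real (Suc N)) s" using anti[of e s] e \<open>s \<in> {a..b}\<close> M by simp
  qed
qed

lemma nonint_imp_margin:
  assumes ab: "a < b" and k: "k1 \<le> k2" and ca: "continuity_assumption a b f g"
    and \<omega>: "continuous_on ({k1..k2} \<times> {a..b}) \<omega>"
    and ni: "\<forall>t\<in>{a..b}. f t < \<omega> (k1, t) \<and> (\<forall>j\<in>{k1..<k2}. \<omega> (j, t) < \<omega> (Suc j, t)) \<and> ereal (\<omega> (k2, t)) < g t"
  shows "\<exists>N. \<forall>s\<in>{a..b}. margin_at k1 k2 f g (1 / real (Suc N)) \<omega> s"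
proof -
  have lim: "((\<lambda>s. \<omega> (j, s)) \<longlongrightarrow> \<omega> (j, t)) (at t within {a..b})" if "j \<in> {k1..k2}" "t \<in> {a..b}" for j t
    using continuous_on_slice[OF \<omega> that(1)] that(2) unfolding continuous_on_def by blast
  have "\<forall>\<^sub>F N in sequentially. \<forall>s\<in>{a..b}. f s + 1 / real (Suc N) \<le> \<omega> (k1, s)"
  proof (rule uniform_margin[where Q = "\<lambda>e s. f s + e \<le> \<omega> (k1, s)"])
    fix t assume t: "t \<in> {a..b}"
    \<comment> \<open>Thirds of the gap: near t the boundary rises by less than one third and the
      curve falls by less than one third, so one third is left. Neighbouring curves are treated in
      the same way below.\<close>
    define e where "e = (\<omega> (k1, t) - f t) / 3"
    have e: "e > 0" using ni t by (simp add: e_def)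
    have "\<forall>\<^sub>F s in at t within {a..b}. f s < f t + e"
      using ca t e unfolding continuity_assumption_def usc_on_def by simp
    moreover have "\<forall>\<^sub>F s in at t within {a..b}. \<omega> (k1, t) - e < \<omega> (k1, s)"
      using k t e by (intro order_tendstoD(1)[OF lim]) auto
    ultimately have "\<forall>\<^sub>F s in at t within {a..b}. f s + e \<le> \<omega> (k1, s)"
      by eventually_elim (simp add: e_def field_simps)
    moreover have "f t + e \<le> \<omega> (k1, t)" using e by (simp add: e_def field_simps)
    ultimately show "\<exists>e>0. f t + e \<le> \<omega> (k1, t) \<and> (\<forall>\<^sub>F s in at t within {a..b}. f s + e \<le> \<omega> (k1, s))"
      using e by blast
  qed (use ab in auto)
  moreover have "\<forall>\<^sub>F N in sequentially. \<forall>j\<in>{k1..<k2}. \<forall>s\<in>{a..b}. \<omega> (j, s) + 1 / real (Suc N) \<le> \<omega> (Suc j, s)"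
  proof (rule eventually_ball_finite, simp, rule ballI)
    fix j assume j: "j \<in> {k1..<k2}"
    show "\<forall>\<^sub>F N in sequentially. \<forall>s\<in>{a..b}. \<omega> (j, s) + 1 / real (Suc N) \<le> \<omega> (Suc j, s)"
    proof (rule uniform_margin[where Q = "\<lambda>e s. \<omega> (j, s) + e \<le> \<omega> (Suc j, s)"])
      fix t assume t: "t \<in> {a..b}"
      define e where "e = (\<omega> (Suc j, t) - \<omega> (j, t)) / 3"
      have e: "e > 0" using ni t j by (simp add: e_def)
      have "\<forall>\<^sub>F s in at t within {a..b}. \<omega> (j, s) < \<omega> (j, t) + e"
        using j t e by (intro order_tendstoD(2)[OF lim]) auto
      moreover have "\<forall>\<^sub>F s in at t within {a..b}. \<omega> (Suc j, t) - e < \<omega> (Suc j, s)"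
        using j t e by (intro order_tendstoD(1)[OF lim]) auto
      ultimately have "\<forall>\<^sub>F s in at t within {a..b}. \<omega> (j, s) + e \<le> \<omega> (Suc j, s)"
        by eventually_elim (simp add: e_def field_simps)
      moreover have "\<omega> (j, t) + e \<le> \<omega> (Suc j, t)" using e by (simp add: e_def field_simps)
      ultimately show "\<exists>e>0. \<omega> (j, t) + e \<le> \<omega> (Suc j, t) \<and>
          (\<forall>\<^sub>F s in at t within {a..b}. \<omega> (j, s) + e \<le> \<omega> (Suc j, s))"
        using e by blast
    qed (use ab in auto)
  qed
  moreover have "\<forall>\<^sub>F N in sequentially. \<forall>s\<in>{a..b}. ereal (\<omega> (k2, s) + 1 / real (Suc N)) \<le> g s"
  proof (rule uniform_margin[where Q = "\<lambda>e s. ereal (\<omega> (k2, s) + e) \<le> g s"])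
    fix t assume t: "t \<in> {a..b}"
    \<comment> \<open>Since \<open>g t\<close> may be infinite, the gap is measured to a real number
      c strictly below it. Half of it absorbs the rise of the curve, the other half is the margin
      that remains.\<close>
    obtain c where c: "ereal (\<omega> (k2, t)) < ereal c" "ereal c < g t"
      using ereal_dense2[of "ereal (\<omega> (k2, t))" "g t"] ni t by blast
    define e where "e = (c - \<omega> (k2, t)) / 2"
    have e: "e > 0" using c by (simp add: e_def)
    have "\<forall>\<^sub>F s in at t within {a..b}. ereal c < g s"
      using ca t c unfolding continuity_assumption_def lsc_on_def by simp
    moreover have "\<forall>\<^sub>F s in at t within {a..b}. \<omega> (k2, s) < \<omega> (k2, t) + e"
      using k t e by (intro order_tendstoD(2)[OF lim]) auto
    ultimately have "\<forall>\<^sub>F s in at t within {a..b}. ereal (\<omega> (k2, s) + e) \<le> g s"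
    proof eventually_elim
      case (elim s)
      then have "ereal (\<omega> (k2, s) + e) \<le> ereal c" by (simp add: e_def field_simps)
      also have "\<dots> < g s" by fact
      finally show ?case by simp
    qed
    moreover have "ereal (\<omega> (k2, t) + e) \<le> g t"
    proof -
      have "ereal (\<omega> (k2, t) + e) \<le> ereal c" using e by (simp add: e_def field_simps)
      also have "\<dots> < g t" by fact
      finally show ?thesis by simp
    qed
    ultimately show "\<exists>e>0. ereal (\<omega> (k2, t) + e) \<le> g t \<and> (\<forall>\<^sub>F s in at t within {a..b}. ereal (\<omega> (k2, s) + e) \<le> g s)"
      using e by blast
  next
    fix e e' s assume "ereal (\<omega> (k2, s) + e) \<le> g s" "e' \<le> e"
    then show "ereal (\<omega> (k2, s) + e') \<le> g s"
      using order_trans[of "ereal (\<omega> (k2, s) + e')" "ereal (\<omega> (k2, s) + e)" "g s"] by simp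
  qed (use ab in auto)
  ultimately have "\<forall>\<^sub>F N in sequentially. \<forall>s\<in>{a..b}. margin_at k1 k2 f g (1 / real (Suc N)) \<omega> s"
    by eventually_elim (auto simp: margin_at_def)
  then show ?thesis
    unfolding eventually_sequentially by blast
qed

text \<open>The event becomes a countable union over the gap of countable intersections over times,
  which is the form to which monotone limits apply.\<close>

lemma nonint_event_eq:
  assumes ab: "a < b" and k: "k1 \<le> k2" and ca: "continuity_assumption a b f g"
  shows "nonint_event k1 k2 a b f g = {\<omega> \<in> space (ensemble_space k1 k2 a b).
    \<exists>N. \<forall>s\<in>rational_times a b. margin_at k1 k2 f g (1 / real (Suc N)) \<omega> s}"
proof (intro set_eqI iffI)
  fix \<omega> assume "\<omega> \<in> nonint_event k1 k2 a b f g"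
  then have \<omega>: "\<omega> \<in> space (ensemble_space k1 k2 a b)"
    and ni: "\<forall>t\<in>{a..b}. f t < \<omega> (k1, t) \<and> (\<forall>j\<in>{k1..<k2}. \<omega> (j, t) < \<omega> (Suc j, t)) \<and> ereal (\<omega> (k2, t)) < g t"
    by (auto simp: nonint_event_def)
  have "continuous_on ({k1..k2} \<times> {a..b}) \<omega>"
    using \<omega> by (simp add: ensemble_space_def space_restrict_space)
  from nonint_imp_margin[OF ab k ca this ni] \<omega>
  show "\<omega> \<in> {\<omega> \<in> space (ensemble_space k1 k2 a b).
      \<exists>N. \<forall>s\<in>rational_times a b. margin_at k1 k2 f g (1 / real (Suc N)) \<omega> s}"
    by fastforce
next
  fix \<omega> assume "\<omega> \<in> {\<omega> \<in> space (ensemble_space k1 k2 a b).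
      \<exists>N. \<forall>s\<in>rational_times a b. margin_at k1 k2 f g (1 / real (Suc N)) \<omega> s}"
  then obtain N where \<omega>: "\<omega> \<in> space (ensemble_space k1 k2 a b)"
    and N: "\<forall>s\<in>rational_times a b. margin_at k1 k2 f g (1 / real (Suc N)) \<omega> s" by blast
  have cont: "continuous_on ({k1..k2} \<times> {a..b}) \<omega>"
    using \<omega> by (simp add: ensemble_space_def space_restrict_space)
  define e where "e = 1 / real (Suc N)"
  have "e > 0" by (simp add: e_def)
  have m: "margin_at k1 k2 f g e \<omega> t" if "t \<in> {a..b}" for t
    using margin_at_rational_times_imp[OF ab k ca cont N that] by (simp add: e_def)
  have "ereal (\<omega> (k2, t)) < g t" if "t \<in> {a..b}" for t
  proof -
    have "ereal (\<omega> (k2, t)) < ereal (\<omega> (k2, t) + e)" using \<open>e > 0\<close> by simp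
    also have "\<dots> \<le> g t" using m[OF that] by (simp add: margin_at_def)
    finally show ?thesis .
  qed
  moreover have "f t < \<omega> (k1, t) \<and> (\<forall>j\<in>{k1..<k2}. \<omega> (j, t) < \<omega> (Suc j, t))" if "t \<in> {a..b}" for t
    using m[OF that] \<open>e > 0\<close> unfolding margin_at_def by fastforce
  ultimately show "\<omega> \<in> nonint_event k1 k2 a b f g"
    using \<omega> by (simp add: nonint_event_def)
qed

section \<open>Monotone coupling of random bits\<close>

abbreviation bit_space :: "(nat \<Rightarrow> bool) measure" where
  "bit_space \<equiv> \<Pi>\<^sub>M n\<in>UNIV. count_space UNIV"

abbreviation uniform_stream :: "(nat \<Rightarrow> real) measure" where
  "uniform_stream \<equiv> \<Pi>\<^sub>M n\<in>UNIV. uniform_measure lborel {0..1}"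

lemma space_bit_space [simp]: "space bit_space = UNIV"
  by (simp add: space_PiM)

lemma bit_cylinder_measurable [measurable]: "{x. \<forall>i<n. x i = \<beta> i} \<in> sets bit_space"
proof -
  have "{x \<in> space bit_space. \<forall>i<n. x i = \<beta> i} \<in> sets bit_space" by measurable
  then show ?thesis by simp
qed

text \<open>A cylinder over finitely many coordinates is a finite disjoint union of complete
  patterns of the first n bits, for n beyond all these coordinates. Such a pattern is encoded by the
  set \<open>S\<close> of positions whose bit is set.\<close>

lemma bit_measure_eqI:
  assumes "finite_measure P" and sets: "sets P = sets bit_space" "sets Q = sets bit_space"
    and eq: "\<And>n \<beta>. emeasure P {x. \<forall>i<n. x i = \<beta> i} = emeasure Q {x. \<forall>i<n. x i = \<beta> i}"
  shows "P = Q"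
proof (rule measure_eqI_PiM_infinite[OF sets _ assms(1)])
  fix A :: "nat \<Rightarrow> bool set" and J :: "nat set"
  assume J: "finite J" "J \<subseteq> UNIV"
  obtain n where n: "J \<subseteq> {..<n}" using J(1) finite_nat_iff_bounded by blast
  define C where "C S = {x. \<forall>i<n. x i = (i \<in> S)}" for S :: "nat set"
  define K where "K = {S \<in> Pow {..<n}. \<forall>j\<in>J. (j \<in> S) \<in> A j}"
  have emb: "prod_emb UNIV (\<lambda>_. count_space UNIV) J (Pi\<^sub>E J A) = (\<Union>S\<in>K. C S)"
  proof (intro set_eqI iffI)
    fix x assume x: "x \<in> prod_emb UNIV (\<lambda>_. count_space UNIV) J (Pi\<^sub>E J A)"
    then have "x \<in> C {i. i < n \<and> x i}" "{i. i < n \<and> x i} \<in> K"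
      using n by (auto simp: C_def K_def prod_emb_def PiE_iff)
    then show "x \<in> (\<Union>S\<in>K. C S)" by blast
  next
    fix x assume "x \<in> (\<Union>S\<in>K. C S)"
    then show "x \<in> prod_emb UNIV (\<lambda>_. count_space UNIV) J (Pi\<^sub>E J A)"
      using n by (auto simp: C_def K_def prod_emb_def PiE_iff subset_iff)
  qed
  have disj: "disjoint_family_on C K"
    unfolding disjoint_family_on_def C_def K_def by blast
  have fin: "finite K" by (simp add: K_def)
  have C: "C S \<in> sets bit_space" for S unfolding C_def by measurable
  show "emeasure P (prod_emb UNIV (\<lambda>_. count_space UNIV) J (Pi\<^sub>E J A)) =
      emeasure Q (prod_emb UNIV (\<lambda>_. count_space UNIV) J (Pi\<^sub>E J A))"
  proof -
    have "emeasure P (\<Union>S\<in>K. C S) = (\<Sum>S\<in>K. emeasure P (C S))"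
      using C fin disj sets by (intro sum_emeasure[symmetric]) auto
    also have "\<dots> = (\<Sum>S\<in>K. emeasure Q (C S))"
      unfolding C_def by (intro sum.cong refl eq)
    also have "\<dots> = emeasure Q (\<Union>S\<in>K. C S)"
      using C fin disj sets by (intro sum_emeasure) auto
    finally show ?thesis unfolding emb .
  qed
qed

text \<open>Bits not yet drawn are padded with \<open>False\<close>. For values of \<open>c\<close>
  in [0, 1], drawing the next bit as \<open>u n < c n (history c u n)\<close> gives it conditional
  probability \<open>c n\<close> of the history.\<close>

primrec history :: "(nat \<Rightarrow> (nat \<Rightarrow> bool) \<Rightarrow> real) \<Rightarrow> (nat \<Rightarrow> real) \<Rightarrow> nat \<Rightarrow> nat \<Rightarrow> bool" where
  "history c u 0 = (\<lambda>_. False)"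
| "history c u (Suc n) = (history c u n)(n := u n < c n (history c u n))"

definition sampled_bits :: "(nat \<Rightarrow> (nat \<Rightarrow> bool) \<Rightarrow> real) \<Rightarrow> (nat \<Rightarrow> real) \<Rightarrow> nat \<Rightarrow> bool" where
  "sampled_bits c u n \<longleftrightarrow> u n < c n (history c u n)"

lemma history_eq: "history c u n = (\<lambda>i. i < n \<and> sampled_bits c u i)"
proof (induction n)
  case (Suc n)
  have "history c u (Suc n) = (history c u n)(n := sampled_bits c u n)"
    by (simp add: sampled_bits_def)
  then show ?case unfolding Suc.IH by (simp add: fun_eq_iff less_Suc_eq)
qed simp

definition adapted :: "(nat \<Rightarrow> (nat \<Rightarrow> bool) \<Rightarrow> real) \<Rightarrow> bool" where
  "adapted c \<longleftrightarrow> (\<forall>n \<beta> \<gamma>. (\<forall>i<n. \<beta> i = \<gamma> i) \<longrightarrow> c n \<beta> = c n \<gamma>)"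

text \<open>As long as the sampled bits follow \<beta>, the random history may be replaced by
  \<beta> in \<open>c\<close>. The thresholds become constants, and a condition on dependent bits
  turns into separate conditions on the independent coordinates of u.\<close>

lemma sampled_bits_cylinder:
  assumes "adapted c"
  shows "(\<forall>i<n. sampled_bits c u i = \<beta> i) \<longleftrightarrow> (\<forall>i<n. (u i < c i \<beta>) = \<beta> i)"
proof (induction n)
  case (Suc n)
  have "sampled_bits c u n \<longleftrightarrow> u n < c n \<beta>" if "\<forall>i<n. sampled_bits c u i = \<beta> i"
  proof -
    have "c n (history c u n) = c n \<beta>"
      using assms[unfolded adapted_def] that by (auto simp: history_eq)
    then show ?thesis by (simp add: sampled_bits_def)
  qed
  then show ?case unfolding All_less_Suc using Suc by blast
qed simp

lemma measurable_sampled_bits: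
  assumes "adapted c"
  shows "sampled_bits c \<in> uniform_stream \<rightarrow>\<^sub>M bit_space"
proof (rule measurable_PiM_single')
  fix n :: nat
  \<comment> \<open>There are finitely many patterns of the first n + 1 bits, and for each of them
    the thresholds are constants; this expresses the bit through measurable conditions on u.\<close>
  have "(\<lambda>u. sampled_bits c u n) = (\<lambda>u. \<exists>S\<in>Pow {..n}. n \<in> S \<and> (\<forall>i<Suc n. (u i < c i (\<lambda>i. i \<in> S)) = (i \<in> S)))"
  proof (intro ext iffI)
    fix u assume "sampled_bits c u n"
    then have "\<forall>i<Suc n. sampled_bits c u i = (i \<in> {i. i \<le> n \<and> sampled_bits c u i})"
      and "n \<in> {i. i \<le> n \<and> sampled_bits c u i}" by auto
    then show "\<exists>S\<in>Pow {..n}. n \<in> S \<and> (\<forall>i<Suc n. (u i < c i (\<lambda>i. i \<in> S)) = (i \<in> S))"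
      unfolding sampled_bits_cylinder[OF assms]
      by (intro bexI[of _ "{i. i \<le> n \<and> sampled_bits c u i}"]) auto
  next
    fix u assume "\<exists>S\<in>Pow {..n}. n \<in> S \<and> (\<forall>i<Suc n. (u i < c i (\<lambda>i. i \<in> S)) = (i \<in> S))"
    then show "sampled_bits c u n"
      unfolding sampled_bits_cylinder[OF assms, symmetric] by auto
  qed
  moreover have "Measurable.pred uniform_stream
      (\<lambda>u. \<exists>S\<in>Pow {..n}. n \<in> S \<and> (\<forall>i<Suc n. (u i < c i (\<lambda>i. i \<in> S)) = (i \<in> S)))"
    by measurable
  ultimately show "(\<lambda>u. sampled_bits c u n) \<in> uniform_stream \<rightarrow>\<^sub>M count_space UNIV"
    by simp
qed (simp add: space_PiM)

lemma prob_space_unit_uniform: "prob_space (uniform_measure lborel {0..1::real})"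
  by (rule prob_space_uniform_measure) auto

text \<open>The pattern is a product event for independent uniform variables; [0, c) has length c
  and [c, 1] has length 1 - c.\<close>

lemma emeasure_sampled_bits:
  assumes "adapted c" and c: "\<And>n. 0 \<le> c n \<beta>" "\<And>n. c n \<beta> \<le> 1"
  shows "emeasure uniform_stream {u. \<forall>i<n. sampled_bits c u i = \<beta> i}
    = ennreal (\<Prod>i<n. if \<beta> i then c i \<beta> else 1 - c i \<beta>)"
proof -
  interpret product_prob_space "\<lambda>_::nat. uniform_measure lborel {0..1::real}" UNIV
    by (intro product_prob_spaceI prob_space_unit_uniform)
  define X where "X i = {x. (x < c i \<beta>) = \<beta> i}" for i
  have X: "X i = (if \<beta> i then {..<c i \<beta>} else {c i \<beta>..})" for i
    by (auto simp: X_def)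
  have X_sets [simp]: "X i \<in> sets borel" for i
    by (simp add: X)
  have val: "emeasure (uniform_measure lborel {0..1}) (X i) = ennreal (if \<beta> i then c i \<beta> else 1 - c i \<beta>)" for i
  proof -
    have "{0..1} \<inter> X i = (if \<beta> i then {0..<c i \<beta>} else {c i \<beta>..1})"
      using c[of i] by (auto simp: X)
    then show ?thesis
      using c[of i] X_sets[of i] by (subst emeasure_uniform_measure) (simp_all add: divide_ennreal_def)
  qed
  have "{u. \<forall>i<n. sampled_bits c u i = \<beta> i} = {u \<in> space uniform_stream. \<forall>i\<in>{..<n}. u i \<in> X i}"
    by (auto simp: sampled_bits_cylinder[OF assms(1)] X_def space_PiM)
  also have "emeasure uniform_stream \<dots> = (\<Prod>i\<in>{..<n}. emeasure (uniform_measure lborel {0..1}) (X i))"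
    by (rule emeasure_PiM_Collect) auto
  also have "\<dots> = ennreal (\<Prod>i<n. if \<beta> i then c i \<beta> else 1 - c i \<beta>)"
    unfolding val by (rule prod_ennreal) (simp add: c)
  finally show ?thesis .
qed

section \<open>Conditional probabilities of successive bits\<close>

definition bit_pattern :: "'a measure \<Rightarrow> (nat \<Rightarrow> 'a set) \<Rightarrow> nat \<Rightarrow> (nat \<Rightarrow> bool) \<Rightarrow> 'a set" where
  "bit_pattern M E n \<beta> = {\<omega> \<in> space M. \<forall>i<n. (\<omega> \<in> E i) = \<beta> i}"

lemma bit_pattern_sets:
  assumes "\<And>n. E n \<in> sets M"
  shows "bit_pattern M E n \<beta> \<in> sets M"
proof -
  note assms[measurable]
  show ?thesis unfolding bit_pattern_def by measurable
qed

text \<open>The conditional probability that bit \<open>n\<close> is set, given the earlier bits; \<open>d\<close> is its value on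
  histories of probability zero.\<close>

definition next_bit_prob :: "real \<Rightarrow> 'a measure \<Rightarrow> (nat \<Rightarrow> 'a set) \<Rightarrow> nat \<Rightarrow> (nat \<Rightarrow> bool) \<Rightarrow> real" where
  "next_bit_prob d M E n \<beta> =
     (if measure M (bit_pattern M E n \<beta>) = 0 then d
      else measure M (bit_pattern M E (Suc n) (\<beta>(n := True))) / measure M (bit_pattern M E n \<beta>))"

lemma adapted_next_bit_prob: "adapted (next_bit_prob d M E)"
  unfolding adapted_def
proof (intro allI impI)
  fix n and \<beta> \<gamma> :: "nat \<Rightarrow> bool"
  assume "\<forall>i<n. \<beta> i = \<gamma> i"
  then have "bit_pattern M E n \<beta> = bit_pattern M E n \<gamma>"
    and "bit_pattern M E (Suc n) (\<beta>(n := True)) = bit_pattern M E (Suc n) (\<gamma>(n := True))"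
    unfolding bit_pattern_def All_less_Suc by auto
  then show "next_bit_prob d M E n \<beta> = next_bit_prob d M E n \<gamma>"
    unfolding next_bit_prob_def by (simp only:)
qed

context prob_space
begin

lemma prob_bit_pattern_split:
  assumes E: "\<And>n. E n \<in> events"
  shows "prob (bit_pattern M E n \<beta>) =
    prob (bit_pattern M E (Suc n) (\<beta>(n := True))) + prob (bit_pattern M E (Suc n) (\<beta>(n := False)))"
proof -
  have "bit_pattern M E n \<beta> = bit_pattern M E (Suc n) (\<beta>(n := True)) \<union> bit_pattern M E (Suc n) (\<beta>(n := False))"
    by (auto simp: bit_pattern_def less_Suc_eq)
  moreover have "bit_pattern M E (Suc n) (\<beta>(n := True)) \<inter> bit_pattern M E (Suc n) (\<beta>(n := False)) = {}"
    by (auto simp: bit_pattern_def less_Suc_eq)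
  ultimately show ?thesis by (simp add: finite_measure_Union bit_pattern_sets[OF E])
qed

lemma next_bit_prob_bounds:
  assumes E: "\<And>n. E n \<in> events" and d: "0 \<le> d" "d \<le> 1"
  shows "0 \<le> next_bit_prob d M E n \<beta>" "next_bit_prob d M E n \<beta> \<le> 1"
proof -
  show "0 \<le> next_bit_prob d M E n \<beta>" using d by (simp add: next_bit_prob_def)
  have "prob (bit_pattern M E (Suc n) (\<beta>(n := True))) \<le> prob (bit_pattern M E n \<beta>)"
    using prob_bit_pattern_split[of E n \<beta>, OF E] by simp
  then show "next_bit_prob d M E n \<beta> \<le> 1"
    using d by (simp add: next_bit_prob_def divide_le_eq_1 zero_less_measure_iff)
qed

text \<open>The chain rule for conditional probabilities. Once a pattern has probability zero so do
  its extensions, hence the default value \<open>d\<close> only ever appears multiplied by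
  0.\<close>

lemma prod_next_bit_prob:
  assumes E: "\<And>n. E n \<in> events"
  shows "(\<Prod>i<n. if \<beta> i then next_bit_prob d M E i \<beta> else 1 - next_bit_prob d M E i \<beta>)
    = prob (bit_pattern M E n \<beta>)"
proof (induction n)
  case 0
  show ?case by (simp add: bit_pattern_def prob_space)
next
  case (Suc n)
  have upd: "\<beta>(n := \<beta> n) = \<beta>" by simp
  note split = prob_bit_pattern_split[of E n \<beta>, OF E]
  show ?case
  proof (cases "prob (bit_pattern M E n \<beta>) = 0")
    case True
    then have "prob (bit_pattern M E (Suc n) (\<beta>(n := b))) = 0" for b
      using split by (cases b) (auto simp: add_nonneg_eq_0_iff)
    from this[of "\<beta> n"] show ?thesis using Suc True by simp
  next
    case False
    then have "prob (bit_pattern M E n \<beta>) * (if b then next_bit_prob d M E n \<beta> else 1 - next_bit_prob d M E n \<beta>)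
        = prob (bit_pattern M E (Suc n) (\<beta>(n := b)))" for b
      using split by (cases b) (auto simp: next_bit_prob_def field_simps)
    from this[of "\<beta> n"] show ?thesis using Suc upd by simp
  qed
qed

lemma distr_sampled_bits:
  assumes E [measurable]: "\<And>n. E n \<in> events" and d: "0 \<le> d" "d \<le> 1"
  shows "distr uniform_stream bit_space (sampled_bits (next_bit_prob d M E))
    = distr M bit_space (\<lambda>\<omega> n. \<omega> \<in> E n)"
proof (rule bit_measure_eqI)
  let ?B = "sampled_bits (next_bit_prob d M E)"
  interpret U: prob_space uniform_stream
    by (intro prob_space_PiM prob_space_unit_uniform)
  have meas [measurable]: "?B \<in> uniform_stream \<rightarrow>\<^sub>M bit_space"
    by (intro measurable_sampled_bits adapted_next_bit_prob)
  have meas' [measurable]: "(\<lambda>\<omega> n. \<omega> \<in> E n) \<in> M \<rightarrow>\<^sub>M bit_space"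
    by (intro measurable_PiM_single') (auto simp: space_PiM)
  show "finite_measure (distr uniform_stream bit_space ?B)"
    using U.prob_space_distr[OF meas] by (rule prob_space.axioms)
  fix n :: nat and \<beta> :: "nat \<Rightarrow> bool"
  have "emeasure (distr uniform_stream bit_space ?B) {x. \<forall>i<n. x i = \<beta> i}
      = emeasure uniform_stream {u. \<forall>i<n. ?B u i = \<beta> i}"
    by (subst emeasure_distr) (auto simp: space_PiM vimage_def)
  also have "\<dots> = ennreal (prob (bit_pattern M E n \<beta>))"
    by (simp add: emeasure_sampled_bits adapted_next_bit_prob next_bit_prob_bounds[OF E d] prod_next_bit_prob[OF E])
  also have "\<dots> = emeasure (distr M bit_space (\<lambda>\<omega> n. \<omega> \<in> E n)) {x. \<forall>i<n. x i = \<beta> i}"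
    by (subst emeasure_distr) (auto simp: bit_pattern_def emeasure_eq_measure vimage_def Int_def conj_commute)
  finally show "emeasure (distr uniform_stream bit_space ?B) {x. \<forall>i<n. x i = \<beta> i}
      = emeasure (distr M bit_space (\<lambda>\<omega> n. \<omega> \<in> E n)) {x. \<forall>i<n. x i = \<beta> i}" .
qed simp_all

end

text \<open>Both bit sequences are sampled with the same uniform variables; the lattice condition makes the
  conditional probabilities monotone in the history, so the order is never violated.\<close>

lemma monotone_bit_coupling:
  assumes "prob_space M1" "prob_space M2"
    and E1: "\<And>n. E1 n \<in> sets M1" and E2: "\<And>n. E2 n \<in> sets M2"
    and holley: "\<And>n \<beta> \<gamma>. measure M1 (bit_pattern M1 E1 n \<beta>) * measure M2 (bit_pattern M2 E2 n \<gamma>)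
      \<le> measure M1 (bit_pattern M1 E1 n (sup \<beta> \<gamma>)) * measure M2 (bit_pattern M2 E2 n (inf \<beta> \<gamma>))"
  shows "\<exists>B1 B2. B1 \<in> uniform_stream \<rightarrow>\<^sub>M bit_space \<and> B2 \<in> uniform_stream \<rightarrow>\<^sub>M bit_space \<and>
    distr uniform_stream bit_space B1 = distr M1 bit_space (\<lambda>\<omega> n. \<omega> \<in> E1 n) \<and>
    distr uniform_stream bit_space B2 = distr M2 bit_space (\<lambda>\<omega> n. \<omega> \<in> E2 n) \<and>
    (\<forall>u n. B2 u n \<longrightarrow> B1 u n)"
proof -
  interpret M1: prob_space M1 by (rule assms(1))
  interpret M2: prob_space M2 by (rule assms(2))
  \<comment> \<open>On null histories the larger ensemble takes the default 1 and the smaller one 0,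
    so the comparison is automatic where a conditional probability is undefined.\<close>
  let ?c1 = "next_bit_prob 1 M1 E1" and ?c2 = "next_bit_prob 0 M2 E2"
  have c_le: "?c2 n \<gamma> \<le> ?c1 n \<beta>" if le: "\<forall>i<n. \<gamma> i \<longrightarrow> \<beta> i" for n \<beta> \<gamma>
  proof -
    let ?p = "measure M1 (bit_pattern M1 E1 n \<beta>)" and ?q = "measure M2 (bit_pattern M2 E2 n \<gamma>)"
    let ?pT = "measure M1 (bit_pattern M1 E1 (Suc n) (\<beta>(n := True)))"
    let ?qT = "measure M2 (bit_pattern M2 E2 (Suc n) (\<gamma>(n := True)))"
    consider "?p = 0" | "?q = 0" | "?p \<noteq> 0" "?q \<noteq> 0" by argo
    then show ?thesis
    proof cases
      case 1
      then have "?c1 n \<beta> = 1" by (simp add: next_bit_prob_def)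
      then show ?thesis using M2.next_bit_prob_bounds(2)[OF E2, of 0] by simp
    next
      case 2
      then have "?c2 n \<gamma> = 0" by (simp add: next_bit_prob_def)
      then show ?thesis using M1.next_bit_prob_bounds(1)[OF E1, of 1] by simp
    next
      case 3
      then have pos: "?p > 0" "?q > 0" by (simp_all only: zero_less_measure_iff not_False_eq_True)
      \<comment> \<open>Holley's condition for patterns that are crossed in bit n only: as \<gamma>
        lies below \<beta> before n, the join is \<beta> with bit n set and the meet is \<gamma>
        with bit n unset. Splitting the totals p and q gives (p - pT) qT \<le> pT (q - qT), that is
        p qT \<le> pT q.\<close>
      have "bit_pattern M1 E1 (Suc n) (sup (\<beta>(n := False)) (\<gamma>(n := True))) = bit_pattern M1 E1 (Suc n) (\<beta>(n := True))"
        unfolding bit_pattern_def All_less_Suc using le by auto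
      moreover have "bit_pattern M2 E2 (Suc n) (inf (\<beta>(n := False)) (\<gamma>(n := True))) = bit_pattern M2 E2 (Suc n) (\<gamma>(n := False))"
        unfolding bit_pattern_def All_less_Suc using le by auto
      moreover note holley[of "Suc n" "\<beta>(n := False)" "\<gamma>(n := True)"]
      moreover note M1.prob_bit_pattern_split[of E1 n \<beta>, OF E1] M2.prob_bit_pattern_split[of E2 n \<gamma>, OF E2]
      ultimately have "(?p - ?pT) * ?qT \<le> ?pT * (?q - ?qT)"
        by simp
      then have "?qT / ?q \<le> ?pT / ?p"
        using pos by (simp add: field_simps)
      then show ?thesis using 3 by (simp add: next_bit_prob_def)
    qed
  qed
  have mono: "sampled_bits ?c2 u n \<Longrightarrow> sampled_bits ?c1 u n" for u n
  proof (induction n rule: less_induct)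
    case (less n)
    have "?c2 n (history ?c2 u n) \<le> ?c1 n (history ?c1 u n)"
      using less.IH by (intro c_le) (auto simp: history_eq)
    then show ?case using less.prems unfolding sampled_bits_def by linarith
  qed
  have "sampled_bits ?c1 \<in> uniform_stream \<rightarrow>\<^sub>M bit_space" "sampled_bits ?c2 \<in> uniform_stream \<rightarrow>\<^sub>M bit_space"
    by (intro measurable_sampled_bits adapted_next_bit_prob)+
  moreover have "distr uniform_stream bit_space (sampled_bits ?c1) = distr M1 bit_space (\<lambda>\<omega> n. \<omega> \<in> E1 n)"
    by (intro M1.distr_sampled_bits E1) auto
  moreover have "distr uniform_stream bit_space (sampled_bits ?c2) = distr M2 bit_space (\<lambda>\<omega> n. \<omega> \<in> E2 n)"
    by (intro M2.distr_sampled_bits E2) auto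
  ultimately show ?thesis using mono by blast
qed

section \<open>The lattice condition for threshold bits\<close>

lemma pred_countable_Ball:
  assumes "countable X" "\<And>i. i \<in> X \<Longrightarrow> Measurable.pred M (P i)"
  shows "Measurable.pred M (\<lambda>x. \<forall>i\<in>X. P i x)"
  using assms unfolding pred_def by (intro sets.sets_Collect_countable_All')

lemma free_bridge_endpoint:
  assumes fb: "free_bridge_law \<alpha> k1 k2 a b x y F" and j: "j \<in> {k1..k2}" and y: "0 \<le> y j" and ab: "a < b"
  shows "AE \<omega> in F. \<omega> (j, b) = y j"
proof -
  obtain S where S: "bessel_bridge \<alpha> (b - a) (sqrt (x j)) (sqrt (y j)) F S"
    and J: "AE \<omega> in F. \<forall>s\<in>{0..b - a}. \<omega> (j, a + s) = (S s \<omega>)\<^sup>2"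
    using fb j unfolding free_bridge_law_def squared_bessel_bridge_on_def squared_bessel_bridge_def by blast
  have "AE \<omega> in F. S 0 \<omega> = sqrt (x j) \<and> S (b - a) \<omega> = sqrt (y j)"
    using S by (simp add: bessel_bridge_def)
  with J show ?thesis
  proof eventually_elim
    case (elim \<omega>)
    from elim(1)[rule_format, of "b - a"] elim(2) ab y show ?case by simp
  qed
qed

text \<open>The path of the bottom curve lies above \<open>f \<ge> 0\<close>, also at time \<open>b\<close>.\<close>

lemma endpoint_pos:
  assumes fb: "free_bridge_law \<alpha> k1 k2 a b x y F" and y: "\<forall>j\<in>{k1..k2}. 0 \<le> y j"
    and ab: "a < b" and ca: "continuity_assumption a b f g"
    and Z: "normalizing_constant k1 k2 a b f g F > 0"
  shows "\<forall>j\<in>{k1..k2}. 0 < y j"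
proof -
  interpret prob_space F using fb by (simp add: free_bridge_law_def)
  have AE_eq: "AE \<omega> in F. \<forall>j\<in>{k1..k2}. \<omega> (j, b) = y j"
    using free_bridge_endpoint[OF fb _ _ ab] y by (intro AE_finite_allI) auto
  have not_AE: "\<not> (AE \<omega> in F. \<omega> \<notin> nonint_event k1 k2 a b f g)"
  proof
    assume "AE \<omega> in F. \<omega> \<notin> nonint_event k1 k2 a b f g"
    \<comment> \<open>A non-measurable set has measure 0 by convention, so this case contradicts
      positivity of the constant too.\<close>
    then have "prob (nonint_event k1 k2 a b f g) = 0"
      using Z measure_notin_sets[of "nonint_event k1 k2 a b f g" F]
      by (cases "nonint_event k1 k2 a b f g \<in> events") (simp_all add: prob_eq_0)
    with Z show False by (simp add: normalizing_constant_def)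
  qed
  have "\<exists>\<omega>. \<omega> \<in> nonint_event k1 k2 a b f g \<and> (\<forall>j\<in>{k1..k2}. \<omega> (j, b) = y j)"
  proof (rule ccontr)
    assume none: "\<not> ?thesis"
    have "AE \<omega> in F. \<omega> \<notin> nonint_event k1 k2 a b f g"
      using AE_eq by eventually_elim (use none in blast)
    with not_AE show False by blast
  qed
  then obtain \<omega> where \<omega>: "\<omega> \<in> nonint_event k1 k2 a b f g" "\<forall>j\<in>{k1..k2}. \<omega> (j, b) = y j"
    by blast
  have "0 \<le> f b" using ca ab by (simp add: continuity_assumption_def)
  have "0 < \<omega> (j, b)" if "k1 \<le> j" "j \<le> k2" for j
    using that
  proof (induction rule: dec_induct)
    case base
    have "f b < \<omega> (k1, b)" using \<omega>(1) ab by (simp add: nonint_event_def)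
    then show ?case using \<open>0 \<le> f b\<close> by simp
  next
    case (step i)
    then have "\<omega> (i, b) < \<omega> (Suc i, b)" using \<omega>(1) ab by (simp add: nonint_event_def)
    then show ?case using step by simp
  qed
  then show ?thesis using \<omega>(2) by fastforce
qed

lemma margin_at_measurable:
  assumes meas: "\<And>j. j \<in> {k1..k2} \<Longrightarrow> (\<lambda>\<omega>. \<omega> (j, s)) \<in> borel_measurable M" and k: "k1 \<le> k2"
  shows "Measurable.pred M (\<lambda>\<omega>. margin_at k1 k2 f g e \<omega> s)"
proof -
  have 1 [measurable]: "(\<lambda>\<omega>. \<omega> (k1, s)) \<in> borel_measurable M" "(\<lambda>\<omega>. \<omega> (k2, s)) \<in> borel_measurable M"
    using k by (auto intro!: meas)
  have "Measurable.pred M (\<lambda>\<omega>. \<omega> (j, s) + e \<le> \<omega> (Suc j, s))" if "j \<in> {k1..<k2}" for j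
    unfolding pred_def using that by (auto intro!: borel_measurable_le borel_measurable_add meas)
  then have [measurable]: "Measurable.pred M (\<lambda>\<omega>. \<forall>j\<in>{k1..<k2}. \<omega> (j, s) + e \<le> \<omega> (Suc j, s))"
    by (intro pred_intros_finite) auto
  show ?thesis unfolding margin_at_def by measurable
qed

lemma rational_times_exhaustion:
  assumes "finite T0" "T0 \<subseteq> rational_times a b" "a < b"
  obtains T :: "nat \<Rightarrow> real set"
  where "\<And>n. finite (T n)" "\<And>n. T n \<noteq> {}" "\<And>n. T0 \<subseteq> T n" "incseq T" "(\<Union>n. T n) = rational_times a b"
proof -
  have ne: "rational_times a b \<noteq> {}" using Rats_dense_in_real[OF assms(3)] by auto
  have count: "countable (rational_times a b)" by (simp add: countable_rat)
  define T where "T n = T0 \<union> from_nat_into (rational_times a b) ` {..n}" for n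
  have "(\<Union>n. T n) = T0 \<union> range (from_nat_into (rational_times a b))"
    by (auto simp: T_def)
  also have "\<dots> = rational_times a b" using range_from_nat_into[OF ne count] assms(2) by blast
  finally have "(\<Union>n. T n) = rational_times a b" .
  moreover have "incseq T" by (auto simp: incseq_def T_def intro!: imageI)
  ultimately show thesis
    using that[of T] assms(1) by (auto simp: T_def)
qed

text \<open>Two monotone limits whose order matters: for a fixed gap the events decrease as times
  are added, and only after all rational times are imposed do they increase as the gap
  shrinks.\<close>

lemma margin_event_limits:
  assumes "prob_space F" and sets_F: "sets F = sets (ensemble_space k1 k2 a b)"
    and ab: "a < b" and k: "k1 \<le> k2" and ca: "continuity_assumption a b f g" and B [measurable]: "B \<in> sets F"
    and T: "\<And>n. finite (T n)" "incseq T" "(\<Union>n. T n) = rational_times a b"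
  defines "A \<equiv> \<lambda>N S. {\<omega> \<in> space F. (\<forall>s\<in>S. margin_at k1 k2 f g (1 / real (Suc N)) \<omega> s) \<and> \<omega> \<in> B}"
  shows "(\<lambda>n. measure F (A N (T n))) \<longlonglongrightarrow> measure F (A N (rational_times a b))"
    and "(\<lambda>N. measure F (A N (rational_times a b))) \<longlonglongrightarrow> measure F (nonint_event k1 k2 a b f g \<inter> B)"
proof -
  interpret prob_space F by fact
  have meas [measurable]: "Measurable.pred F (\<lambda>\<omega>. margin_at k1 k2 f g e \<omega> s)" if "s \<in> rational_times a b" for s e
    using that by (intro margin_at_measurable ensemble_eval_measurable[OF sets_F] k) auto
  have A: "A N S \<in> events" if "S \<subseteq> rational_times a b" for N S
  proof -
    have "countable S" using that by (rule countable_subset) (simp add: countable_rat)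
    then have [measurable]: "Measurable.pred F (\<lambda>\<omega>. \<forall>s\<in>S. margin_at k1 k2 f g (1 / real (Suc N)) \<omega> s)"
      using that by (intro pred_countable_Ball \<open>countable S\<close> meas) auto
    show ?thesis unfolding A_def by measurable
  qed
  have "(\<lambda>n. measure F (A N (T n))) \<longlonglongrightarrow> measure F (\<Inter>n. A N (T n))"
  proof (rule finite_Lim_measure_decseq)
    show "range (\<lambda>n. A N (T n)) \<subseteq> events" using A T(3) by blast
    show "decseq (\<lambda>n. A N (T n))"
      using T(2) unfolding decseq_def incseq_def A_def by blast
  qed
  also have "(\<Inter>n. A N (T n)) = A N (rational_times a b)"
    unfolding T(3)[symmetric] A_def by auto
  finally show "(\<lambda>n. measure F (A N (T n))) \<longlonglongrightarrow> measure F (A N (rational_times a b))" .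
  have "(\<lambda>N. measure F (A N (rational_times a b))) \<longlonglongrightarrow> measure F (\<Union>N. A N (rational_times a b))"
  proof (rule finite_Lim_measure_incseq)
    show "range (\<lambda>N. A N (rational_times a b)) \<subseteq> events" using A by blast
    show "incseq (\<lambda>N. A N (rational_times a b))"
      unfolding incseq_def
    proof (intro allI impI)
      fix M N :: nat assume "M \<le> N"
      then have "1 / real (Suc N) \<le> 1 / real (Suc M)" by (intro divide_left_mono) auto
      then show "A M (rational_times a b) \<subseteq> A N (rational_times a b)"
        unfolding A_def using margin_at_mono by blast
    qed
  qed
  also have "(\<Union>N. A N (rational_times a b)) = nonint_event k1 k2 a b f g \<inter> B"
    unfolding nonint_event_eq[OF ab k ca] A_def using sets_eq_imp_space_eq[OF sets_F] by auto
  finally show "(\<lambda>N. measure F (A N (rational_times a b))) \<longlonglongrightarrow> measure F (nonint_event k1 k2 a b f g \<inter> B)" .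
qed

text \<open>Maximum and minimum are monotone and commute with adding \<open>e\<close>, so gaps
  between neighbouring curves persist. At the boundaries the order of the data enters: the maximum
  stays below g1 as g2 \<le> g1, and the minimum stays above f2 as f2 \<le> f1.\<close>

lemma margin_at_lattice:
  assumes "margin_at k1 k2 f1 g1 e \<omega> s" "margin_at k1 k2 f2 g2 e \<eta> s" "f2 s \<le> f1 s" "g2 s \<le> g1 s"
  shows "margin_at k1 k2 f1 g1 e (sup \<omega> \<eta>) s" "margin_at k1 k2 f2 g2 e (inf \<omega> \<eta>) s"
proof -
  have \<eta>: "ereal (\<eta> (k2, s) + e) \<le> g2 s" and \<omega>: "ereal (\<omega> (k2, s) + e) \<le> g1 s"
    using assms by (simp_all add: margin_at_def)
  have "ereal (sup \<omega> \<eta> (k2, s) + e) \<le> g1 s"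
    using \<omega> order_trans[OF \<eta> assms(4)] by (simp add: sup_max max_def)
  moreover have "f1 s + e \<le> sup \<omega> \<eta> (k1, s)"
    using assms(1) by (simp add: margin_at_def sup_max le_max_iff_disj)
  moreover have "sup \<omega> \<eta> (j, s) + e \<le> sup \<omega> \<eta> (Suc j, s)" if "j \<in> {k1..<k2}" for j
    using assms(1,2) that by (force simp add: margin_at_def sup_max max_def)
  ultimately show "margin_at k1 k2 f1 g1 e (sup \<omega> \<eta>) s" by (simp add: margin_at_def)
  have "ereal (inf \<omega> \<eta> (k2, s) + e) \<le> ereal (\<eta> (k2, s) + e)" by (simp add: inf_min)
  then have "ereal (inf \<omega> \<eta> (k2, s) + e) \<le> g2 s" using \<eta> by (rule order_trans)
  moreover have "f2 s + e \<le> inf \<omega> \<eta> (k1, s)"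
    using assms by (auto simp add: margin_at_def inf_min)
  moreover have "inf \<omega> \<eta> (j, s) + e \<le> inf \<omega> \<eta> (Suc j, s)" if "j \<in> {k1..<k2}" for j
    using assms(1,2) that by (force simp add: margin_at_def inf_min min_def)
  ultimately show "margin_at k1 k2 f2 g2 e (inf \<omega> \<eta>) s" by (simp add: margin_at_def)
qed

text \<open>Formulated for the free laws intersected with the non-intersection event: in this form
  it passes through the limits from finitely many times, and the normalizing constants can be
  divided out at the end.\<close>

lemma nonint_bits_lattice_inequality:
  fixes \<theta> :: "nat \<Rightarrow> (nat \<times> real) \<times> real"
  assumes \<alpha>: "0 \<le> \<alpha>" and k: "k1 \<le> k2" and ab: "a < b"
    and fb1: "free_bridge_law \<alpha> k1 k2 a b x1 y1 F1" and fb2: "free_bridge_law \<alpha> k1 k2 a b x2 y2 F2"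
    and x: "\<forall>j\<in>{k1..k2}. 0 \<le> x2 j \<and> x2 j \<le> x1 j" and y: "\<forall>j\<in>{k1..k2}. 0 < y2 j \<and> y2 j \<le> y1 j"
    and ca1: "continuity_assumption a b f1 g1" and ca2: "continuity_assumption a b f2 g2"
    and fg: "\<forall>t\<in>{a..b}. f2 t \<le> f1 t \<and> g2 t \<le> g1 t"
    and \<theta>: "\<And>i. fst (\<theta> i) \<in> {k1..k2} \<times> rational_times a b"
  defines "E1 \<equiv> \<lambda>i. {\<omega> \<in> space F1. snd (\<theta> i) \<le> \<omega> (fst (\<theta> i))}"
    and "E2 \<equiv> \<lambda>i. {\<omega> \<in> space F2. snd (\<theta> i) \<le> \<omega> (fst (\<theta> i))}"
  shows "measure F1 (nonint_event k1 k2 a b f1 g1 \<inter> bit_pattern F1 E1 n \<beta>) *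
      measure F2 (nonint_event k1 k2 a b f2 g2 \<inter> bit_pattern F2 E2 n \<gamma>)
    \<le> measure F1 (nonint_event k1 k2 a b f1 g1 \<inter> bit_pattern F1 E1 n (sup \<beta> \<gamma>)) *
      measure F2 (nonint_event k1 k2 a b f2 g2 \<inter> bit_pattern F2 E2 n (inf \<beta> \<gamma>))"
proof -
  have p1: "prob_space F1" and s1: "sets F1 = sets (ensemble_space k1 k2 a b)"
    and p2: "prob_space F2" and s2: "sets F2 = sets (ensemble_space k1 k2 a b)"
    using fb1 fb2 by (simp_all add: free_bridge_law_def)
  have E_sets: "{\<omega> \<in> space F. snd (\<theta> i) \<le> \<omega> (fst (\<theta> i))} \<in> sets F"
    if "sets F = sets (ensemble_space k1 k2 a b)" for F i
  proof -
    have [measurable]: "(\<lambda>\<omega>. \<omega> (fst (\<theta> i))) \<in> borel_measurable F"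
      using ensemble_eval_measurable[OF that, of "fst (fst (\<theta> i))" "snd (fst (\<theta> i))"] \<theta>[of i]
      by (cases "\<theta> i") auto
    show ?thesis by measurable
  qed
  \<comment> \<open>The times read by the first n bits. They belong to every finite stage, so the
    bit pattern depends on the sampled times throughout the limit.\<close>
  define T0 where "T0 = (\<lambda>i. snd (fst (\<theta> i))) ` {..<n}"
  have "snd (fst (\<theta> i)) \<in> rational_times a b" for i using \<theta>[of i] by (simp add: mem_Times_iff)
  then have T0: "finite T0" "T0 \<subseteq> rational_times a b" by (auto simp only: T0_def finite_imageI finite_lessThan)
  obtain T where T: "\<And>n. finite (T n)" "\<And>n. T n \<noteq> {}" "\<And>n. T0 \<subseteq> T n" "incseq T"
      "(\<Union>n. T n) = rational_times a b"
    using rational_times_exhaustion[OF T0 ab] by blast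
  define A1 where "A1 \<delta> N S = {\<omega> \<in> space F1. (\<forall>s\<in>S. margin_at k1 k2 f1 g1 (1 / real (Suc N)) \<omega> s) \<and> \<omega> \<in> bit_pattern F1 E1 n \<delta>}"
    for \<delta> N S
  define A2 where "A2 \<delta> N S = {\<omega> \<in> space F2. (\<forall>s\<in>S. margin_at k1 k2 f2 g2 (1 / real (Suc N)) \<omega> s) \<and> \<omega> \<in> bit_pattern F2 E2 n \<delta>}"
    for \<delta> N S
  have fin: "measure F1 (A1 \<beta> N (T l)) * measure F2 (A2 \<gamma> N (T l))
      \<le> measure F1 (A1 (sup \<beta> \<gamma>) N (T l)) * measure F2 (A2 (inf \<beta> \<gamma>) N (T l))" for N l
  proof -
    let ?S = "T l" and ?e = "1 / real (Suc N)"
    have S: "finite ?S" "?S \<noteq> {}" "?S \<subseteq> {a<..<b}" using T by auto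
    \<comment> \<open>The four events are numbered 1 to 4; odd numbers belong to the first ensemble
      and even ones to the second.\<close>
    define ff where "ff i = (if odd i then f1 else f2)" for i :: nat
    define gg where "gg i = (if odd i then g1 else g2)" for i :: nat
    define bb where "bb i = (if i = 1 then \<beta> else if i = 2 then \<gamma> else if i = 3 then sup \<beta> \<gamma> else inf \<beta> \<gamma>)" for i :: nat
    define P where "P i \<omega> \<longleftrightarrow> (\<forall>s\<in>?S. margin_at k1 k2 (ff i) (gg i) ?e \<omega> s) \<and>
        (\<forall>r<n. (snd (\<theta> r) \<le> \<omega> (fst (\<theta> r))) = bb i r)" for i \<omega>
    have \<theta>S: "fst (\<theta> r) \<in> {k1..k2} \<times> ?S" if "r < n" for r
    proof -
      have "snd (fst (\<theta> r)) \<in> ?S" using that T(3)[of l] by (auto simp: T0_def)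
      then show ?thesis using \<theta>[of r] by (cases "fst (\<theta> r)") auto
    qed
    have "measure F1 {\<omega>\<in>space F1. P 1 \<omega>} * measure F2 {\<omega>\<in>space F2. P 2 \<omega>}
        \<le> measure F1 {\<omega>\<in>space F1. P 3 \<omega>} * measure F2 {\<omega>\<in>space F2. P 4 \<omega>}"
    proof (rule free_bridge_lattice_inequality[OF \<alpha> k fb1 fb2 x y S])
      show "P i (restrict \<omega> ({k1..k2} \<times> ?S)) = P i \<omega>" for i \<omega>
        unfolding P_def margin_at_def using \<theta>S k by (intro arg_cong2[where f = "(\<and>)"] ball_cong) auto
      show "Measurable.pred (\<Pi>\<^sub>M p\<in>{k1..k2} \<times> ?S. borel) (P i)" for i
      proof -
        have "Measurable.pred (\<Pi>\<^sub>M p\<in>{k1..k2} \<times> ?S. borel) (\<lambda>\<omega>. margin_at k1 k2 (ff i) (gg i) ?e \<omega> s)" if "s \<in> ?S" for s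
          using that by (intro margin_at_measurable k measurable_component_singleton) auto
        then have 1: "Measurable.pred (\<Pi>\<^sub>M p\<in>{k1..k2} \<times> ?S. borel)
            (\<lambda>\<omega>. \<forall>s\<in>?S. margin_at k1 k2 (ff i) (gg i) ?e \<omega> s)"
          using S(1) by (intro pred_intros_finite) auto
        have "Measurable.pred (\<Pi>\<^sub>M p\<in>{k1..k2} \<times> ?S. borel) (\<lambda>\<omega>. (snd (\<theta> r) \<le> \<omega> (fst (\<theta> r))) = bb i r)"
          if "r \<in> {..<n}" for r
        proof -
          have [measurable]: "(\<lambda>\<omega>. \<omega> (fst (\<theta> r))) \<in> borel_measurable (\<Pi>\<^sub>M p\<in>{k1..k2} \<times> ?S. borel)"
            using \<theta>S that by (intro measurable_component_singleton) auto
          show ?thesis by measurable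
        qed
        then have "Measurable.pred (\<Pi>\<^sub>M p\<in>{k1..k2} \<times> ?S. borel) (\<lambda>\<omega>. \<forall>r\<in>{..<n}. (snd (\<theta> r) \<le> \<omega> (fst (\<theta> r))) = bb i r)"
          by (intro pred_intros_finite) auto
        then have 2: "Measurable.pred (\<Pi>\<^sub>M p\<in>{k1..k2} \<times> ?S. borel)
            (\<lambda>\<omega>. \<forall>r<n. (snd (\<theta> r) \<le> \<omega> (fst (\<theta> r))) = bb i r)"
          by (simp only: Ball_def lessThan_iff)
        have "P i = (\<lambda>\<omega>. (\<forall>s\<in>?S. margin_at k1 k2 (ff i) (gg i) ?e \<omega> s) \<and>
            (\<forall>r<n. (snd (\<theta> r) \<le> \<omega> (fst (\<theta> r))) = bb i r))"
          by (simp add: fun_eq_iff P_def)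
        with pred_intros_logic(3)[OF 1 2] show ?thesis by (simp only:)
      qed
      fix \<omega> \<eta> assume P: "P 1 \<omega>" "P 2 \<eta>"
      have le: "f2 s \<le> f1 s" "g2 s \<le> g1 s" if "s \<in> ?S" for s
        using that S(3) fg by force+
      have "margin_at k1 k2 f1 g1 ?e (sup \<omega> \<eta>) s \<and> margin_at k1 k2 f2 g2 ?e (inf \<omega> \<eta>) s" if "s \<in> ?S" for s
        using P that margin_at_lattice[of k1 k2 f1 g1 ?e \<omega> s f2 g2 \<eta>] le[OF that]
        unfolding P_def ff_def gg_def by simp
      \<comment> \<open>In a linear order a threshold lies below the maximum iff it lies below one
        of the values, and below the minimum iff it lies below both.\<close>
      moreover have "\<forall>r<n. (snd (\<theta> r) \<le> sup \<omega> \<eta> (fst (\<theta> r))) = sup \<beta> \<gamma> r \<and>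
          (snd (\<theta> r) \<le> inf \<omega> \<eta> (fst (\<theta> r))) = inf \<beta> \<gamma> r"
        using P unfolding P_def bb_def by (auto simp: sup_max le_max_iff_disj)
      ultimately show "P 3 (sup \<omega> \<eta>) \<and> P 4 (inf \<omega> \<eta>)"
        unfolding P_def ff_def gg_def bb_def by simp
    qed
    moreover have "{\<omega>\<in>space F1. P 1 \<omega>} = A1 \<beta> N ?S" "{\<omega>\<in>space F1. P 3 \<omega>} = A1 (sup \<beta> \<gamma>) N ?S"
      "{\<omega>\<in>space F2. P 2 \<omega>} = A2 \<gamma> N ?S" "{\<omega>\<in>space F2. P 4 \<omega>} = A2 (inf \<beta> \<gamma>) N ?S"
      unfolding P_def A1_def A2_def bit_pattern_def E1_def E2_def ff_def gg_def bb_def by auto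
    ultimately show ?thesis by simp
  qed
  note B1 = bit_pattern_sets[of E1 F1, unfolded E1_def, OF E_sets[OF s1], folded E1_def]
  note B2 = bit_pattern_sets[of E2 F2, unfolded E2_def, OF E_sets[OF s2], folded E2_def]
  have L1: "(\<lambda>l. measure F1 (A1 \<delta> N (T l))) \<longlonglongrightarrow> measure F1 (A1 \<delta> N (rational_times a b))"
    "(\<lambda>N. measure F1 (A1 \<delta> N (rational_times a b))) \<longlonglongrightarrow>
      measure F1 (nonint_event k1 k2 a b f1 g1 \<inter> bit_pattern F1 E1 n \<delta>)" for \<delta> N
    unfolding A1_def by (rule margin_event_limits[OF p1 s1 ab k ca1 B1 T(1,4,5)])+
  have L2: "(\<lambda>l. measure F2 (A2 \<delta> N (T l))) \<longlonglongrightarrow> measure F2 (A2 \<delta> N (rational_times a b))"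
    "(\<lambda>N. measure F2 (A2 \<delta> N (rational_times a b))) \<longlonglongrightarrow>
      measure F2 (nonint_event k1 k2 a b f2 g2 \<inter> bit_pattern F2 E2 n \<delta>)" for \<delta> N
    unfolding A2_def by (rule margin_event_limits[OF p2 s2 ab k ca2 B2 T(1,4,5)])+
  have "measure F1 (A1 \<beta> N (rational_times a b)) * measure F2 (A2 \<gamma> N (rational_times a b))
      \<le> measure F1 (A1 (sup \<beta> \<gamma>) N (rational_times a b)) * measure F2 (A2 (inf \<beta> \<gamma>) N (rational_times a b))" for N
    by (rule LIMSEQ_le[OF tendsto_mult[OF L1(1) L2(1)] tendsto_mult[OF L1(1) L2(1)]]) (use fin in blast)
  then show ?thesis
    by (intro LIMSEQ_le[OF tendsto_mult[OF L1(2) L2(2)] tendsto_mult[OF L1(2) L2(2)]]) blast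
qed

section \<open>Curves from threshold bits\<close>

text \<open>The supremum of the thresholds at c whose bit is set, taken in the extended reals so
  that it exists for every bit sequence; an infinite value, possible only for sequences that encode
  no curve, is read as 0.\<close>

definition decode_value :: "(nat \<Rightarrow> (nat \<times> real) \<times> real) \<Rightarrow> (nat \<Rightarrow> bool) \<Rightarrow> nat \<times> real \<Rightarrow> real" where
  "decode_value \<theta> \<beta> c = real_of_ereal (SUP n. if \<beta> n \<and> fst (\<theta> n) = c then ereal (snd (\<theta> n)) else - \<infinity>)"

lemma decode_value_threshold_bits:
  assumes c: "\<And>q. q \<in> \<rat> \<Longrightarrow> (c, q) \<in> range \<theta>" and \<beta>: "\<And>n. \<beta> n \<longleftrightarrow> snd (\<theta> n) \<le> \<omega> (fst (\<theta> n))"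
  shows "decode_value \<theta> \<beta> c = \<omega> c"
proof -
  let ?g = "\<lambda>n. if \<beta> n \<and> fst (\<theta> n) = c then ereal (snd (\<theta> n)) else - \<infinity>"
  have "(SUP n. ?g n) = ereal (\<omega> c)"
  proof (rule antisym)
    show "(SUP n. ?g n) \<le> ereal (\<omega> c)" by (rule SUP_least) (auto simp: \<beta>)
    show "ereal (\<omega> c) \<le> (SUP n. ?g n)"
    proof (rule dense_le)
      fix z assume "z < ereal (\<omega> c)"
      then obtain r where r: "z < ereal r" "ereal r < ereal (\<omega> c)" using ereal_dense2 by blast
      then obtain q where q: "q \<in> \<rat>" "r < q" "q < \<omega> c" using Rats_dense_in_real[of r "\<omega> c"] by auto
      obtain n where n: "\<theta> n = (c, q)" using c[OF q(1)] by (auto simp: image_def)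
      then have "?g n = ereal q" using q \<beta>[of n] by simp
      then have "ereal q \<le> (SUP n. ?g n)" using SUP_upper[of n UNIV ?g] by (simp only: UNIV_I)
      moreover have "z \<le> ereal q" using less_le_trans[OF r(1), of "ereal q"] q(2) by simp
      ultimately show "z \<le> (SUP n. ?g n)" by (rule order_trans[rotated])
    qed
  qed
  then show ?thesis by (simp add: decode_value_def)
qed

lemma decode_value_measurable [measurable]: "(\<lambda>\<beta>. decode_value \<theta> \<beta> c) \<in> borel_measurable bit_space"
proof -
  have [measurable]: "Measurable.pred bit_space (\<lambda>\<beta>. \<beta> n)" for n
    by measurable
  show ?thesis unfolding decode_value_def by measurable
qed

text \<open>Singles out the bit sequences whose decoded values extend continuously. It is uniform
  continuity, spelled with countable quantifiers for the sake of measurability.\<close>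

definition uniformly_decodable ::
  "nat \<Rightarrow> nat \<Rightarrow> real \<Rightarrow> real \<Rightarrow> (nat \<Rightarrow> (nat \<times> real) \<times> real) \<Rightarrow> (nat \<Rightarrow> bool) \<Rightarrow> bool" where
  "uniformly_decodable k1 k2 a b \<theta> \<beta> \<longleftrightarrow>
     (\<forall>j\<in>{k1..k2}. \<forall>k. \<exists>l. \<forall>s\<in>rational_times a b. \<forall>r\<in>rational_times a b.
        \<bar>s - r\<bar> < 1 / real (Suc l) \<longrightarrow> \<bar>decode_value \<theta> \<beta> (j, s) - decode_value \<theta> \<beta> (j, r)\<bar> < 1 / real (Suc k))"

lemma uniformly_decodable_measurable [measurable]:
  "Measurable.pred bit_space (uniformly_decodable k1 k2 a b \<theta>)"
proof -
  have count: "countable (rational_times a b)" by (simp add: countable_rat)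
  have "Measurable.pred bit_space (\<lambda>\<beta>. \<forall>j\<in>{k1..k2}. \<forall>k::nat. \<exists>l::nat. \<forall>s\<in>rational_times a b. \<forall>r\<in>rational_times a b.
        \<bar>s - r\<bar> < 1 / real (Suc l) \<longrightarrow> \<bar>decode_value \<theta> \<beta> (j, s) - decode_value \<theta> \<beta> (j, r)\<bar> < 1 / real (Suc k))"
    by (intro pred_countable_Ball count pred_intros_countable) (simp, measurable)
  then show ?thesis by (simp only: uniformly_decodable_def[abs_def])
qed

lemma uniformly_decodable_iff:
  "uniformly_decodable k1 k2 a b \<theta> \<beta> \<longleftrightarrow>
     (\<forall>j\<in>{k1..k2}. uniformly_continuous_on (rational_times a b) (\<lambda>s. decode_value \<theta> \<beta> (j, s)))"
proof -
  have "(\<forall>k. \<exists>l. \<forall>s\<in>S. \<forall>r\<in>S. \<bar>s - r\<bar> < 1 / real (Suc l) \<longrightarrow> \<bar>h s - h r\<bar> < 1 / real (Suc k))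
      \<longleftrightarrow> uniformly_continuous_on S h" for S and h :: "real \<Rightarrow> real"
  proof
    assume L: "\<forall>k. \<exists>l. \<forall>s\<in>S. \<forall>r\<in>S. \<bar>s - r\<bar> < 1 / real (Suc l) \<longrightarrow> \<bar>h s - h r\<bar> < 1 / real (Suc k)"
    show "uniformly_continuous_on S h"
      unfolding uniformly_continuous_on_def
    proof (intro allI impI)
      fix e :: real assume "0 < e"
      then obtain k where k: "1 / real (Suc k) < e" using nat_approx_posE by blast
      obtain l where l: "\<forall>s\<in>S. \<forall>r\<in>S. \<bar>s - r\<bar> < 1 / real (Suc l) \<longrightarrow> \<bar>h s - h r\<bar> < 1 / real (Suc k)"
        using L by blast
      show "\<exists>d>0. \<forall>x\<in>S. \<forall>x'\<in>S. dist x' x < d \<longrightarrow> dist (h x') (h x) < e"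
        using l k by (intro exI[of _ "1 / real (Suc l)"]) (fastforce simp: dist_real_def)
    qed
  next
    assume R: "uniformly_continuous_on S h"
    show "\<forall>k. \<exists>l. \<forall>s\<in>S. \<forall>r\<in>S. \<bar>s - r\<bar> < 1 / real (Suc l) \<longrightarrow> \<bar>h s - h r\<bar> < 1 / real (Suc k)"
    proof
      fix k :: nat
      have "0 < 1 / real (Suc k)" by simp
      then obtain d where d: "d > 0" "\<forall>x\<in>S. \<forall>x'\<in>S. dist x' x < d \<longrightarrow> dist (h x') (h x) < 1 / real (Suc k)"
        using R unfolding uniformly_continuous_on_def by blast
      obtain l where l: "1 / real (Suc l) < d" using d(1) nat_approx_posE by blast
      show "\<exists>l. \<forall>s\<in>S. \<forall>r\<in>S. \<bar>s - r\<bar> < 1 / real (Suc l) \<longrightarrow> \<bar>h s - h r\<bar> < 1 / real (Suc k)"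
        using d(2) l by (intro exI[of _ l]) (auto simp: dist_real_def)
    qed
  qed
  then show ?thesis unfolding uniformly_decodable_def by simp
qed

section \<open>Continuous extension from the rational times\<close>

lemma closure_rational_times: "a < b \<Longrightarrow> closure (rational_times a b) = {a..b}"
  using closure_open_Int_superset[of "{a<..<b}" "\<rat>"] by (simp add: Rats_closure_real Int_commute)

lemma ex_rational_times_sequences:
  assumes "a < b"
  shows "\<exists>\<sigma>. \<forall>t\<in>{a..b}. (\<forall>n. \<sigma> t n \<in> rational_times a b) \<and> \<sigma> t \<longlonglongrightarrow> t"
proof (rule bchoice, rule ballI)
  fix t assume "t \<in> {a..b}"
  then have "t \<in> closure (rational_times a b)" by (simp only: closure_rational_times[OF assms])
  then show "\<exists>x. (\<forall>n. x n \<in> rational_times a b) \<and> x \<longlonglongrightarrow> t"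
    by (simp only: closure_sequential)
qed

lemma continuous_on_slices:
  fixes \<omega> :: "nat \<times> real \<Rightarrow> real"
  assumes "finite K" "closed S" "\<And>j. j \<in> K \<Longrightarrow> continuous_on S (\<lambda>s. \<omega> (j, s))"
  shows "continuous_on (K \<times> S) \<omega>"
proof -
  have "continuous_on (\<Union>j\<in>K. {j} \<times> S) \<omega>"
  proof (rule continuous_on_closed_Union[OF assms(1)])
    fix j assume j: "j \<in> K"
    show "closed ({j} \<times> S)" using assms(2) by (intro closed_Times) auto
    have "continuous_on ({j} \<times> S) (\<lambda>p. \<omega> (j, snd p))"
      by (rule continuous_on_compose2[OF assms(3)[OF j]]) (auto intro!: continuous_intros)
    then show "continuous_on ({j} \<times> S) \<omega>"
      by (rule continuous_on_eq) auto
  qed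
  also have "(\<Union>j\<in>K. {j} \<times> S) = K \<times> S" by auto
  finally show ?thesis .
qed

text \<open>One fixed sequence \<sigma> per time makes every coordinate a pointwise limit of
  measurable functions. Bit sequences that do not decode are sent to the zero path, so that the
  result always lies in the ensemble space.\<close>

definition decode_path ::
  "nat \<Rightarrow> nat \<Rightarrow> real \<Rightarrow> real \<Rightarrow> (nat \<Rightarrow> (nat \<times> real) \<times> real) \<Rightarrow> (real \<Rightarrow> nat \<Rightarrow> real) \<Rightarrow>
     (nat \<Rightarrow> bool) \<Rightarrow> ensemble" where
  "decode_path k1 k2 a b \<theta> \<sigma> \<beta> = (\<lambda>p\<in>{k1..k2} \<times> {a..b}.
     if uniformly_decodable k1 k2 a b \<theta> \<beta> then lim (\<lambda>n. decode_value \<theta> \<beta> (fst p, \<sigma> (snd p) n)) else 0)"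

lemma space_ensemble_space:
  "\<omega> \<in> space (ensemble_space k1 k2 a b) \<longleftrightarrow>
     \<omega> \<in> extensional ({k1..k2} \<times> {a..b}) \<and> continuous_on ({k1..k2} \<times> {a..b}) \<omega>"
  by (auto simp: ensemble_space_def space_restrict_space space_PiM PiE_iff)

context
  fixes k1 k2 :: nat and a b :: real and \<sigma> :: "real \<Rightarrow> nat \<Rightarrow> real"
  assumes ab: "a < b"
    and \<sigma>: "\<forall>t\<in>{a..b}. (\<forall>n. \<sigma> t n \<in> rational_times a b) \<and> \<sigma> t \<longlonglongrightarrow> t"
begin

lemma \<sigma>_in: "t \<in> {a..b} \<Longrightarrow> \<sigma> t n \<in> rational_times a b"
  and \<sigma>_lim: "t \<in> {a..b} \<Longrightarrow> \<sigma> t \<longlonglongrightarrow> t"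
  using \<sigma> by blast+

lemma ensemble_lim:
  assumes "\<omega> \<in> space (ensemble_space k1 k2 a b)" "j \<in> {k1..k2}" "t \<in> {a..b}"
  shows "(\<lambda>n. \<omega> (j, \<sigma> t n)) \<longlonglongrightarrow> \<omega> (j, t)"
proof -
  have "continuous_on {a..b} (\<lambda>s. \<omega> (j, s))"
    using assms(1,2) by (intro continuous_on_slice) (auto simp: space_ensemble_space)
  moreover have "\<forall>n. \<sigma> t n \<in> {a..b}" using \<sigma>_in[OF assms(3)] by (auto simp: less_imp_le)
  ultimately show ?thesis
    using \<sigma>_lim[OF assms(3)] assms(3) unfolding continuous_on_sequentially comp_def by blast
qed

lemma decode_path_in_space: "decode_path k1 k2 a b \<theta> \<sigma> \<beta> \<in> space (ensemble_space k1 k2 a b)"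
  unfolding space_ensemble_space
proof
  show "decode_path k1 k2 a b \<theta> \<sigma> \<beta> \<in> extensional ({k1..k2} \<times> {a..b})"
    by (simp add: decode_path_def)
  show "continuous_on ({k1..k2} \<times> {a..b}) (decode_path k1 k2 a b \<theta> \<sigma> \<beta>)"
  proof (rule continuous_on_slices)
    fix j assume j: "j \<in> {k1..k2}"
    show "continuous_on {a..b} (\<lambda>s. decode_path k1 k2 a b \<theta> \<sigma> \<beta> (j, s))"
    proof (cases "uniformly_decodable k1 k2 a b \<theta> \<beta>")
      case False
      then have "decode_path k1 k2 a b \<theta> \<sigma> \<beta> (j, s) = 0" if "s \<in> {a..b}" for s
        using j that by (simp add: decode_path_def)
      then show ?thesis by (intro continuous_on_eq[OF continuous_on_const[of _ 0]]) simp
    next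
      case True
      let ?h = "\<lambda>s. decode_value \<theta> \<beta> (j, s)"
      have "uniformly_continuous_on (rational_times a b) ?h"
        using True j by (simp add: uniformly_decodable_iff)
      \<comment> \<open>Uniform continuity on a dense set gives a continuous extension, and the
        limits along \<sigma> agree with it whatever sequences were chosen.\<close>
      then obtain g where "uniformly_continuous_on (closure (rational_times a b)) g"
        and gh: "\<And>x. x \<in> rational_times a b \<Longrightarrow> ?h x = g x"
        by (rule uniformly_continuous_on_extension_on_closure) blast
      then have g: "continuous_on {a..b} g"
        by (simp add: closure_rational_times[OF ab] uniformly_continuous_imp_continuous)
      have "decode_path k1 k2 a b \<theta> \<sigma> \<beta> (j, t) = g t" if t: "t \<in> {a..b}" for t
      proof -
        have "\<forall>n. \<sigma> t n \<in> {a..b}" using \<sigma>_in[OF t] by (auto simp: less_imp_le)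
        then have "(\<lambda>n. g (\<sigma> t n)) \<longlonglongrightarrow> g t"
          using g \<sigma>_lim[OF t] t unfolding continuous_on_sequentially comp_def by blast
        then have "(\<lambda>n. ?h (\<sigma> t n)) \<longlonglongrightarrow> g t" using gh[OF \<sigma>_in[OF t]] by simp
        then show ?thesis using True j t by (simp add: decode_path_def limI)
      qed
      then show ?thesis by (intro continuous_on_eq[OF g]) simp
    qed
  qed simp_all
qed

lemma decode_path_measurable: "decode_path k1 k2 a b \<theta> \<sigma> \<in> bit_space \<rightarrow>\<^sub>M ensemble_space k1 k2 a b"
  unfolding ensemble_space_def
proof (rule measurable_restrict_space2)
  show "decode_path k1 k2 a b \<theta> \<sigma> \<in> space bit_space \<rightarrow> {\<omega>. continuous_on ({k1..k2} \<times> {a..b}) \<omega>}"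
    using decode_path_in_space by (auto simp: space_ensemble_space)
  show "decode_path k1 k2 a b \<theta> \<sigma> \<in> bit_space \<rightarrow>\<^sub>M (\<Pi>\<^sub>M p\<in>{k1..k2} \<times> {a..b}. borel)"
    unfolding decode_path_def[abs_def]
    by (rule measurable_restrict) measurable
qed

text \<open>Decoding is a left inverse of reading bits: a curve is uniformly continuous on the
  compact interval, so its bits decode, and the limits from rational times return it. Off the index
  set both sides are \<open>undefined\<close>.\<close>

lemma decode_path_threshold_bits:
  assumes \<omega>: "\<omega> \<in> space (ensemble_space k1 k2 a b)"
    and \<theta>: "range \<theta> = ({k1..k2} \<times> rational_times a b) \<times> \<rat>"
    and \<beta>: "\<And>n. \<beta> n \<longleftrightarrow> snd (\<theta> n) \<le> \<omega> (fst (\<theta> n))"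
  shows "decode_path k1 k2 a b \<theta> \<sigma> \<beta> = \<omega>"
proof
  fix p
  have val: "decode_value \<theta> \<beta> (j, s) = \<omega> (j, s)" if "j \<in> {k1..k2}" "s \<in> rational_times a b" for j s
    using that \<theta> by (intro decode_value_threshold_bits \<beta>) auto
  have "uniformly_continuous_on (rational_times a b) (\<lambda>s. decode_value \<theta> \<beta> (j, s))" if j: "j \<in> {k1..k2}" for j
  proof -
    have "continuous_on {a..b} (\<lambda>s. \<omega> (j, s))"
      using \<omega> j by (intro continuous_on_slice) (auto simp: space_ensemble_space)
    then have "uniformly_continuous_on {a..b} (\<lambda>s. \<omega> (j, s))"
      by (intro compact_uniformly_continuous) auto
    moreover have "rational_times a b \<subseteq> {a..b}" by auto
    ultimately have "uniformly_continuous_on (rational_times a b) (\<lambda>s. \<omega> (j, s))"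
      unfolding uniformly_continuous_on_def by (meson subsetD)
    then show ?thesis using val[OF j] unfolding uniformly_continuous_on_def by simp
  qed
  then have dec: "uniformly_decodable k1 k2 a b \<theta> \<beta>" by (simp add: uniformly_decodable_iff)
  show "decode_path k1 k2 a b \<theta> \<sigma> \<beta> p = \<omega> p"
  proof (cases "p \<in> {k1..k2} \<times> {a..b}")
    case False
    moreover have "\<omega> p = undefined"
      using \<omega> False unfolding space_ensemble_space by (blast intro: extensional_arb)
    ultimately show ?thesis unfolding decode_path_def by (simp only: restrict_apply if_False)
  next
    case True
    then obtain j t where p: "p = (j, t)" "j \<in> {k1..k2}" "t \<in> {a..b}" by auto
    have "(\<lambda>n. decode_value \<theta> \<beta> (j, \<sigma> t n)) \<longlonglongrightarrow> \<omega> (j, t)"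
      using ensemble_lim[OF \<omega> p(2,3)] val[OF p(2) \<sigma>_in[OF p(3)]] by simp
    then show ?thesis using dec p by (simp add: decode_path_def limI)
  qed
qed

lemma ensemble_le_of_rational_times:
  assumes "\<omega> \<in> space (ensemble_space k1 k2 a b)" "\<eta> \<in> space (ensemble_space k1 k2 a b)"
    and le: "\<forall>c\<in>{k1..k2} \<times> rational_times a b. \<eta> c \<le> \<omega> c" and "j \<in> {k1..k2}" "t \<in> {a..b}"
  shows "\<eta> (j, t) \<le> \<omega> (j, t)"
proof (rule LIMSEQ_le[OF ensemble_lim[OF assms(2,4,5)] ensemble_lim[OF assms(1,4,5)]])
  have "\<eta> (j, \<sigma> t n) \<le> \<omega> (j, \<sigma> t n)" for n
    using \<sigma>_in[OF assms(5)] assms(4) by (intro le[rule_format] SigmaI)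
  then show "\<exists>N. \<forall>n\<ge>N. \<eta> (j, \<sigma> t n) \<le> \<omega> (j, \<sigma> t n)" by blast
qed

end

section \<open>Conditioned laws and the final coupling\<close>

lemma nonint_law_props:
  assumes fb: "free_bridge_law \<alpha> k1 k2 a b x y F" and Z: "normalizing_constant k1 k2 a b f g F > 0"
  shows "prob_space (nonint_law k1 k2 a b f g F)"
    and "sets (nonint_law k1 k2 a b f g F) = sets (ensemble_space k1 k2 a b)"
    and "space (nonint_law k1 k2 a b f g F) = space F"
    and "B \<in> sets F \<Longrightarrow> measure (nonint_law k1 k2 a b f g F) B =
      measure F (nonint_event k1 k2 a b f g \<inter> B) / normalizing_constant k1 k2 a b f g F"
proof -
  interpret prob_space F using fb by (simp add: free_bridge_law_def)
  have ne: "emeasure F (nonint_event k1 k2 a b f g) \<noteq> 0"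
    using Z by (simp add: normalizing_constant_def emeasure_eq_measure)
  then show "prob_space (nonint_law k1 k2 a b f g F)"
    unfolding nonint_law_def by (intro prob_space_uniform_measure) auto
  show "sets (nonint_law k1 k2 a b f g F) = sets (ensemble_space k1 k2 a b)"
    using fb by (simp add: nonint_law_def free_bridge_law_def)
  show "space (nonint_law k1 k2 a b f g F) = space F"
    by (simp add: nonint_law_def)
  show "measure (nonint_law k1 k2 a b f g F) B =
      measure F (nonint_event k1 k2 a b f g \<inter> B) / normalizing_constant k1 k2 a b f g F" if "B \<in> sets F"
    unfolding nonint_law_def normalizing_constant_def using ne that by (intro measure_uniform_measure) auto
qed

text \<open>As decoding inverts the bit map on M, equality of bit laws becomes equality of path
  laws. The last claim says that a sampled bit sequence is almost surely the one read off its
  decoded path; it holds for bits of actual paths and is transported by the common law.\<close>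

lemma decoded_law:
  assumes ab: "a < b"
    and \<sigma>: "\<forall>t\<in>{a..b}. (\<forall>n. \<sigma> t n \<in> rational_times a b) \<and> \<sigma> t \<longlonglongrightarrow> t"
    and \<theta>: "range \<theta> = ({k1..k2} \<times> rational_times a b) \<times> \<rat>"
    and sets_M: "sets M = sets (ensemble_space k1 k2 a b)"
    and B: "B \<in> U \<rightarrow>\<^sub>M bit_space"
    and law: "distr U bit_space B = distr M bit_space (\<lambda>\<omega> n. \<omega> \<in> {\<omega> \<in> space M. snd (\<theta> n) \<le> \<omega> (fst (\<theta> n))})"
  shows "(\<lambda>u. decode_path k1 k2 a b \<theta> \<sigma> (B u)) \<in> U \<rightarrow>\<^sub>M M"
    and "distr U M (\<lambda>u. decode_path k1 k2 a b \<theta> \<sigma> (B u)) = M"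
    and "AE u in U. \<forall>n. B u n \<longleftrightarrow> snd (\<theta> n) \<le> decode_path k1 k2 a b \<theta> \<sigma> (B u) (fst (\<theta> n))"
proof -
  let ?D = "decode_path k1 k2 a b \<theta> \<sigma>"
  let ?\<Phi> = "\<lambda>\<omega> n. \<omega> \<in> {\<omega> \<in> space M. snd (\<theta> n) \<le> \<omega> (fst (\<theta> n))}"
  have space_M: "space M = space (ensemble_space k1 k2 a b)"
    using sets_M by (rule sets_eq_imp_space_eq)
  have D: "?D \<in> bit_space \<rightarrow>\<^sub>M M"
    using decode_path_measurable[of a b \<sigma> k1 k2 \<theta>, OF ab \<sigma>] measurable_cong_sets[OF refl sets_M] by blast
  have \<theta>_in: "fst (\<theta> n) \<in> {k1..k2} \<times> rational_times a b" for n
    using rangeI[of \<theta> n] unfolding \<theta> by (simp add: mem_Times_iff)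
  have eval: "(\<lambda>\<omega>. \<omega> (fst (\<theta> n))) \<in> borel_measurable M" for n
    using ensemble_eval_measurable[OF sets_M, of "fst (fst (\<theta> n))" "snd (fst (\<theta> n))"] \<theta>_in[of n]
    by (auto simp: mem_Times_iff)
  have \<Phi>: "?\<Phi> \<in> M \<rightarrow>\<^sub>M bit_space"
  proof (rule measurable_PiM_single')
    fix n
    note eval[of n, measurable]
    show "(\<lambda>\<omega>. ?\<Phi> \<omega> n) \<in> M \<rightarrow>\<^sub>M count_space UNIV" by measurable
  qed (simp add: space_PiM)
  have inv: "?D (?\<Phi> \<omega>) = \<omega>" if "\<omega> \<in> space M" for \<omega>
    using that space_M by (intro decode_path_threshold_bits[OF ab \<sigma> _ \<theta>]) auto
  show DB: "(\<lambda>u. ?D (B u)) \<in> U \<rightarrow>\<^sub>M M" using measurable_compose[OF B D] .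
  have "distr U M (\<lambda>u. ?D (B u)) = distr (distr U bit_space B) M ?D"
    using distr_distr[OF D B] by (simp add: comp_def)
  also have "\<dots> = distr M M (\<lambda>\<omega>. ?D (?\<Phi> \<omega>))"
    unfolding law using distr_distr[OF D \<Phi>] by (simp add: comp_def)
  also have "\<dots> = distr M M (\<lambda>\<omega>. \<omega>)" by (rule distr_cong) (simp_all only: inv)
  also have "\<dots> = M" by simp
  finally show "distr U M (\<lambda>u. ?D (B u)) = M" .
  have "AE u in U. B u n \<longleftrightarrow> snd (\<theta> n) \<le> ?D (B u) (fst (\<theta> n))" for n
  proof -
    let ?R = "\<lambda>\<beta>. \<beta> n \<longleftrightarrow> snd (\<theta> n) \<le> ?D \<beta> (fst (\<theta> n))"
    have [measurable]: "(\<lambda>\<beta>. ?D \<beta> (fst (\<theta> n))) \<in> borel_measurable bit_space"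
      using measurable_compose[OF D eval] .
    have R: "{\<beta> \<in> space bit_space. ?R \<beta>} \<in> sets bit_space" by measurable
    have "AE \<omega> in M. ?R (?\<Phi> \<omega>)" by (rule AE_I2) (simp add: inv del: mem_Collect_eq, simp)
    then have "AE \<beta> in distr U bit_space B. ?R \<beta>"
      unfolding law using AE_distr_iff[OF \<Phi> R] by blast
    then show ?thesis using AE_distr_iff[OF B R] by blast
  qed
  then show "AE u in U. \<forall>n. B u n \<longleftrightarrow> snd (\<theta> n) \<le> ?D (B u) (fst (\<theta> n))"
    by (simp add: AE_all_countable)
qed

theorem proposition4p1:
  fixes \<alpha> a b :: real and k1 k2 :: nat
    and x1 x2 y1 y2 :: "nat \<Rightarrow> real"
    and f1 f2 :: "real \<Rightarrow> real" and g1 g2 :: "real \<Rightarrow> ereal"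
    and F1 F2 :: "ensemble measure"
  assumes "0 \<le> \<alpha>" and "1 \<le> k1" and "k1 \<le> k2" and "a < b"
    and "\<forall>j\<in>{k1..k2}. 0 \<le> x1 j \<and> 0 \<le> x2 j \<and> 0 \<le> y1 j \<and> 0 \<le> y2 j"
    and "\<forall>j\<in>{k1..k2}. x1 j \<ge> x2 j \<and> y1 j \<ge> y2 j"
    and "continuity_assumption a b f1 g1" and "continuity_assumption a b f2 g2"
    and "\<forall>t\<in>{a..b}. f1 t \<ge> f2 t \<and> g1 t \<ge> g2 t"
    and "free_bridge_law \<alpha> k1 k2 a b x1 y1 F1" and "free_bridge_law \<alpha> k1 k2 a b x2 y2 F2"
    and "normalizing_constant k1 k2 a b f1 g1 F1 > 0"
    and "normalizing_constant k1 k2 a b f2 g2 F2 > 0"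
  shows "\<exists>\<mu>. coupling \<mu> (nonint_law k1 k2 a b f1 g1 F1) (nonint_law k1 k2 a b f2 g2 F2) \<and>
    (AE (q1, q2) in \<mu>. \<forall>j\<in>{k1..k2}. \<forall>t\<in>{a..b}. q1 (j, t) \<ge> q2 (j, t))"
proof -
  note ab = assms(4) and fb1 = assms(10) and fb2 = assms(11) and Z1 = assms(12) and Z2 = assms(13)
  define M1 where "M1 = nonint_law k1 k2 a b f1 g1 F1"
  define M2 where "M2 = nonint_law k1 k2 a b f2 g2 F2"
  note M1 = nonint_law_props[OF fb1 Z1, folded M1_def] and M2 = nonint_law_props[OF fb2 Z2, folded M2_def]
  have spaces: "space M1 = space (ensemble_space k1 k2 a b)" "space M2 = space (ensemble_space k1 k2 a b)"
    by (rule sets_eq_imp_space_eq[OF M1(2)], rule sets_eq_imp_space_eq[OF M2(2)])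
  let ?C = "{k1..k2} \<times> rational_times a b"
  have count: "countable ?C" by (intro countable_SIGMA) (auto simp: countable_rat)
  have "rational_times a b \<noteq> {}" using Rats_dense_in_real[OF ab] by auto
  then have ne: "?C \<times> \<rat> \<noteq> {}" using assms(3) by (auto simp: Rats_0 intro!: exI[of _ "0::real"])
  \<comment> \<open>Any order of the bits will do, as the lattice condition holds for all of them;
    every combination of curve, time and threshold has to occur for the decoding.\<close>
  define \<theta> where "\<theta> = from_nat_into (?C \<times> (\<rat> :: real set))"
  have \<theta>: "range \<theta> = ?C \<times> \<rat>"
    unfolding \<theta>_def by (rule range_from_nat_into[OF ne]) (rule countable_SIGMA[OF count countable_rat])
  have \<theta>_in: "fst (\<theta> n) \<in> ?C" for n
    using rangeI[of \<theta> n] unfolding \<theta> by (simp add: mem_Times_iff)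
  obtain \<sigma> where \<sigma>: "\<forall>t\<in>{a..b}. (\<forall>n. \<sigma> t n \<in> rational_times a b) \<and> \<sigma> t \<longlonglongrightarrow> t"
    using ex_rational_times_sequences[OF ab] by blast
  define E1 where "E1 n = {\<omega> \<in> space M1. snd (\<theta> n) \<le> \<omega> (fst (\<theta> n))}" for n
  define E2 where "E2 n = {\<omega> \<in> space M2. snd (\<theta> n) \<le> \<omega> (fst (\<theta> n))}" for n
  have eval: "(\<lambda>\<omega>. \<omega> c) \<in> borel_measurable M"
    if "c \<in> ?C" "sets M = sets (ensemble_space k1 k2 a b)" for c and M :: "ensemble measure"
    using ensemble_eval_measurable[OF that(2), of "fst c" "snd c"] that(1) by (auto simp: mem_Times_iff)
  have E1: "E1 n \<in> sets M1" and E2: "E2 n \<in> sets M2" for n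
  proof -
    note eval[OF \<theta>_in M1(2), measurable] eval[OF \<theta>_in M2(2), measurable]
    show "E1 n \<in> sets M1" "E2 n \<in> sets M2" unfolding E1_def E2_def by measurable
  qed
  \<comment> \<open>As y1 \<ge> y2, all exit data are positive and the bridge densities avoid their
    limiting form.\<close>
  have ypos: "\<forall>j\<in>{k1..k2}. 0 < y2 j"
    using endpoint_pos[OF fb2 _ ab assms(8) Z2] assms(5) by blast
  have sF: "sets M1 = sets F1" "sets M2 = sets F2"
    using M1(2) M2(2) fb1 fb2 by (simp_all add: free_bridge_law_def)
  have "measure M1 (bit_pattern M1 E1 n \<beta>) * measure M2 (bit_pattern M2 E2 n \<gamma>)
      \<le> measure M1 (bit_pattern M1 E1 n (sup \<beta> \<gamma>)) * measure M2 (bit_pattern M2 E2 n (inf \<beta> \<gamma>))" for n \<beta> \<gamma>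
  proof -
    let ?z1 = "normalizing_constant k1 k2 a b f1 g1 F1" and ?z2 = "normalizing_constant k1 k2 a b f2 g2 F2"
    let ?A1 = "nonint_event k1 k2 a b f1 g1" and ?A2 = "nonint_event k1 k2 a b f2 g2"
    have m1: "measure M1 (bit_pattern M1 E1 n \<delta>) = measure F1 (?A1 \<inter> bit_pattern M1 E1 n \<delta>) / ?z1" for \<delta>
      by (rule M1(4)) (use bit_pattern_sets[of E1 M1, OF E1] sF in simp)
    have m2: "measure M2 (bit_pattern M2 E2 n \<delta>) = measure F2 (?A2 \<inter> bit_pattern M2 E2 n \<delta>) / ?z2" for \<delta>
      by (rule M2(4)) (use bit_pattern_sets[of E2 M2, OF E2] sF in simp)
    have p: "bit_pattern M1 E1 n \<delta> = bit_pattern F1 (\<lambda>i. {\<omega> \<in> space F1. snd (\<theta> i) \<le> \<omega> (fst (\<theta> i))}) n \<delta>"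
      "bit_pattern M2 E2 n \<delta> = bit_pattern F2 (\<lambda>i. {\<omega> \<in> space F2. snd (\<theta> i) \<le> \<omega> (fst (\<theta> i))}) n \<delta>" for \<delta>
      unfolding bit_pattern_def E1_def E2_def M1(3) M2(3) by (rule refl)+
    have "measure F1 (?A1 \<inter> bit_pattern M1 E1 n \<beta>) * measure F2 (?A2 \<inter> bit_pattern M2 E2 n \<gamma>)
        \<le> measure F1 (?A1 \<inter> bit_pattern M1 E1 n (sup \<beta> \<gamma>)) * measure F2 (?A2 \<inter> bit_pattern M2 E2 n (inf \<beta> \<gamma>))"
      unfolding p using assms(5,6,9) ypos
      by (intro nonint_bits_lattice_inequality[OF assms(1,3,4) fb1 fb2 _ _ assms(7,8) _ \<theta>_in]) auto
    \<comment> \<open>Both sides carry the same pair of normalizing constants, so the inequality for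
      the free laws is Holley's condition for the conditioned ones.\<close>
    then have "(measure F1 (?A1 \<inter> bit_pattern M1 E1 n \<beta>) * measure F2 (?A2 \<inter> bit_pattern M2 E2 n \<gamma>)) / (?z1 * ?z2)
        \<le> (measure F1 (?A1 \<inter> bit_pattern M1 E1 n (sup \<beta> \<gamma>)) * measure F2 (?A2 \<inter> bit_pattern M2 E2 n (inf \<beta> \<gamma>))) / (?z1 * ?z2)"
      using Z1 Z2 by (intro divide_right_mono) auto
    then show ?thesis by (simp only: m1 m2 times_divide_times_eq)
  qed
  from monotone_bit_coupling[OF M1(1) M2(1) E1 E2 this]
  obtain B1 B2 where B: "B1 \<in> uniform_stream \<rightarrow>\<^sub>M bit_space" "B2 \<in> uniform_stream \<rightarrow>\<^sub>M bit_space"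
    and law1: "distr uniform_stream bit_space B1 = distr M1 bit_space (\<lambda>\<omega> n. \<omega> \<in> E1 n)"
    and law2: "distr uniform_stream bit_space B2 = distr M2 bit_space (\<lambda>\<omega> n. \<omega> \<in> E2 n)"
    and mono: "\<And>u n. B2 u n \<Longrightarrow> B1 u n"
    by (elim exE conjE) blast
  let ?D = "decode_path k1 k2 a b \<theta> \<sigma>"
  note dec1 = decoded_law[OF ab \<sigma> \<theta> M1(2) B(1) law1[unfolded E1_def]]
  note dec2 = decoded_law[OF ab \<sigma> \<theta> M2(2) B(2) law2[unfolded E2_def]]
  let ?P = "\<lambda>u. (?D (B1 u), ?D (B2 u))"
  have P: "?P \<in> uniform_stream \<rightarrow>\<^sub>M M1 \<Otimes>\<^sub>M M2" using dec1(1) dec2(1) by (rule measurable_Pair)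
  define \<mu> where "\<mu> = distr uniform_stream (M1 \<Otimes>\<^sub>M M2) ?P"
  interpret U: prob_space uniform_stream by (intro prob_space_PiM prob_space_unit_uniform)
  have "prob_space \<mu>" unfolding \<mu>_def by (rule U.prob_space_distr[OF P])
  moreover have "distr \<mu> M1 fst = M1"
    unfolding \<mu>_def using distr_distr[OF measurable_fst P] dec1(2) by (simp add: comp_def)
  moreover have "distr \<mu> M2 snd = M2"
    unfolding \<mu>_def using distr_distr[OF measurable_snd P] dec2(2) by (simp add: comp_def)
  ultimately have "coupling \<mu> M1 M2" by (simp add: coupling_def \<mu>_def)
  moreover have "AE (q1, q2) in \<mu>. \<forall>j\<in>{k1..k2}. \<forall>t\<in>{a..b}. q1 (j, t) \<ge> q2 (j, t)"
  proof -
    have "AE u in uniform_stream. \<forall>c\<in>?C. ?D (B2 u) c \<le> ?D (B1 u) c"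
      using dec1(3) dec2(3)
    proof eventually_elim
      case (elim u)
      show ?case
      proof (intro ballI, rule ccontr)
        \<comment> \<open>A rational threshold strictly between two values in the wrong order would
          have its bit set in the second sequence and unset in the first.\<close>
        fix c assume c: "c \<in> ?C" and "\<not> ?D (B2 u) c \<le> ?D (B1 u) c"
        then obtain q where q: "q \<in> \<rat>" "?D (B1 u) c < q" "q < ?D (B2 u) c"
          using Rats_dense_in_real[of "?D (B1 u) c" "?D (B2 u) c"] by auto
        have "(c, q) \<in> range \<theta>" using \<theta> c q(1) by simp
        then obtain n where n: "\<theta> n = (c, q)" by (auto simp: image_def)
        have "B2 u n" using elim(2) n q(3) by simp
        then have "B1 u n" by (rule mono)
        then have "q \<le> ?D (B1 u) c" using elim(1) n by simp
        with q(2) show False by simp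
      qed
    qed
    \<comment> \<open>Measurability is checked for the countably many coordinates in
      \<open>?C\<close>; continuity of the paths extends the order to all times afterwards.\<close>
    moreover have "{q \<in> space (M1 \<Otimes>\<^sub>M M2). \<forall>c\<in>?C. snd q c \<le> fst q c} \<in> sets (M1 \<Otimes>\<^sub>M M2)"
    proof -
      have "Measurable.pred (M1 \<Otimes>\<^sub>M M2) (\<lambda>q. \<forall>c\<in>?C. snd q c \<le> fst q c)"
      proof (rule pred_countable_Ball[OF count])
        fix c assume c: "c \<in> ?C"
        have "(\<lambda>q. fst q c) \<in> borel_measurable (M1 \<Otimes>\<^sub>M M2)" "(\<lambda>q. snd q c) \<in> borel_measurable (M1 \<Otimes>\<^sub>M M2)"
          using measurable_compose[OF measurable_fst eval[OF c M1(2)]]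
            measurable_compose[OF measurable_snd eval[OF c M2(2)]] by auto
        then show "Measurable.pred (M1 \<Otimes>\<^sub>M M2) (\<lambda>q. snd q c \<le> fst q c)"
          unfolding pred_def by (intro borel_measurable_le)
      qed
      then show ?thesis by (simp add: pred_def)
    qed
    ultimately have "AE q in \<mu>. \<forall>c\<in>?C. snd q c \<le> fst q c"
      unfolding \<mu>_def by (subst AE_distr_iff[OF P]) simp_all
    moreover have "AE q in \<mu>. q \<in> space \<mu>" by (rule AE_space)
    ultimately show ?thesis
    proof eventually_elim
      case (elim q)
      have "fst q \<in> space (ensemble_space k1 k2 a b)" "snd q \<in> space (ensemble_space k1 k2 a b)"
        using elim(2) spaces by (auto simp: \<mu>_def space_pair_measure)
      then show ?case
        using ensemble_le_of_rational_times[OF ab \<sigma> _ _ elim(1)] by (auto simp: case_prod_beta)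
    qed
  qed
  ultimately show ?thesis unfolding M1_def M2_def by blast
qed

end
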